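(* Let $k$ be a positive integer and let $\Delta$ be a (finite) simplicial complex that is $k$-fold acyclic over a field $\Bbbk$. Then the face poset of $\Delta$ can be written as a disjoint union of boolean trees of rank $k$. Furthermore, this can be done so that the minimal faces of these boolean trees together form a subcomplex $\Delta'$ of $\Delta$.
   Context: A simplicial complex is a nonempty collection of subsets (faces) of a finite set closed under taking subsets; the empty set is a face. The face poset is the set of all faces, including the empty face, ordered by inclusion. The link of a face $\sigma$ is $\operatorname{link}_\Delta\sigma=\{\tau\in\Delta : \tau\cup\sigma\in\Delta,\ \tau\cap\sigma=\varnothing\}$. A complex is acyclic (over $\Bbbk$) if all its reduced homology groups over $\Bbbk$ (including degree $-1$) vanish. $\Delta$ is $k$-fold acyclic if $\operatorname{link}_\Delta\sigma$ is acyclic for all $\sigma\in\Delta$ with $|\sigma|<k$. In a poset $P$, $y$ covers $x$ if $x<y$ and there is no $z$ with $x<z<y$. A boolean tree of rank $i$ is a subposet of a poset $P$, with a unique minimal element, defined recursively: any subposet with exactly one element is a boolean tree of rank $0$; if $T_1$ and $T_2$ are disjoint boolean trees of rank $i-1$ with minimal elements $r_1$ and $r_2$ respectively, such that $r_2$ covers $r_1$ in $P$, then $T_1\cup T_2$ is a boolean tree of rank $i$, with $r_1$ as its unique minimal element. *)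

theory Defs
  imports "HOL-Algebra.Elementary_Groups" "HOL-Library.Disjoint_Sets"
begin

section \<open>Simplicial complexes\<close>

definition simplicial_complex :: "'a set set \<Rightarrow> bool" where
  "simplicial_complex \<Delta> \<longleftrightarrow>
     \<Delta> \<noteq> {} \<and> (\<exists>V. finite V \<and> \<Delta> \<subseteq> Pow V) \<and> (\<forall>\<sigma>\<in>\<Delta>. \<forall>\<tau>. \<tau> \<subseteq> \<sigma> \<longrightarrow> \<tau> \<in> \<Delta>)"

definition subcomplex :: "'a set set \<Rightarrow> 'a set set \<Rightarrow> bool" where
  "subcomplex \<Delta>' \<Delta> \<longleftrightarrow> simplicial_complex \<Delta>' \<and> \<Delta>' \<subseteq> \<Delta>"

definition link :: "'a set set \<Rightarrow> 'a set \<Rightarrow> 'a set set" where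
  "link \<Delta> \<sigma> = {\<tau> \<in> \<Delta>. \<tau> \<union> \<sigma> \<in> \<Delta> \<and> \<tau> \<inter> \<sigma> = {}}"


section \<open>Reduced simplicial homology over a field\<close>

text \<open>
  Faces are oriented by a total order on the vertices. Homology does not depend on this order
  up to isomorphism, so one order is fixed once and for all for each vertex type.
\<close>

definition vertex_order :: "'a rel" where
  "vertex_order = (SOME r. well_order_on UNIV r)"

definition vertex_less :: "'a \<Rightarrow> 'a \<Rightarrow> bool" where
  "vertex_less u v \<longleftrightarrow> (u, v) \<in> vertex_order \<and> u \<noteq> v"

lemma well_order_on_vertex_order: "well_order_on UNIV vertex_order"
  unfolding vertex_order_def by (rule someI_ex) (rule well_order_on)

text \<open>
  A \<open>p\<close>-chain is given by its coefficients on the faces. The empty face is a face of dimension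
  \<open>-1\<close>, which makes the resulting complex the augmented one.
\<close>

definition chains :: "int \<Rightarrow> 'a set set \<Rightarrow> ('a set \<Rightarrow> 'f::field) set" where
  "chains p \<Delta> = {c. \<forall>\<sigma>. c \<sigma> \<noteq> 0 \<longrightarrow> \<sigma> \<in> \<Delta> \<and> int (card \<sigma>) = p + 1}"

text \<open>
  The linear extension of \<open>\<sigma> \<mapsto> \<Sum>i. (-1)^i (\<sigma> - {v\<^sub>i})\<close> for a face \<open>\<sigma>\<close> with vertices
  \<open>v\<^sub>0 < v\<^sub>1 < \<dots>\<close>; the index of a vertex \<open>v\<close> is the number of smaller vertices of \<open>\<sigma>\<close>.
\<close>

definition boundary :: "'a set set \<Rightarrow> ('a set \<Rightarrow> 'f::field) \<Rightarrow> 'a set \<Rightarrow> 'f" where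
  "boundary \<Delta> c = (\<lambda>\<tau>. \<Sum>\<sigma>\<in>\<Delta>. \<Sum>v\<in>\<sigma>.
     if \<tau> = \<sigma> - {v} then (- 1) ^ card {u \<in> \<sigma>. vertex_less u v} * c \<sigma> else 0)"

definition cycles :: "int \<Rightarrow> 'a set set \<Rightarrow> ('a set \<Rightarrow> 'f::field) set" where
  "cycles p \<Delta> = {c \<in> chains p \<Delta>. boundary \<Delta> c = (\<lambda>_. 0)}"

definition boundaries :: "int \<Rightarrow> 'a set set \<Rightarrow> ('a set \<Rightarrow> 'f::field) set" where
  "boundaries p \<Delta> = boundary \<Delta> ` chains (p + 1) \<Delta>"

definition cycle_group :: "int \<Rightarrow> 'a set set \<Rightarrow> ('a set \<Rightarrow> 'f::field) monoid" where
  "cycle_group p \<Delta> = \<lparr>carrier = cycles p \<Delta>, monoid.mult = (\<lambda>c d \<sigma>. c \<sigma> + d \<sigma>), one = (\<lambda>_. 0)\<rparr>"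

definition reduced_homology_group ::
    "int \<Rightarrow> 'a set set \<Rightarrow> ('a set \<Rightarrow> 'f::field) set monoid" where
  "reduced_homology_group p \<Delta> = cycle_group p \<Delta> Mod boundaries p \<Delta>"

definition acyclic_over :: "'f::field itself \<Rightarrow> 'a set set \<Rightarrow> bool" where
  "acyclic_over _ \<Delta> \<longleftrightarrow>
     (\<forall>p \<ge> -1. trivial_group (reduced_homology_group p \<Delta> :: ('a set \<Rightarrow> 'f) set monoid))"

definition k_fold_acyclic :: "'f::field itself \<Rightarrow> nat \<Rightarrow> 'a set set \<Rightarrow> bool" where
  "k_fold_acyclic F k \<Delta> \<longleftrightarrow> (\<forall>\<sigma>\<in>\<Delta>. card \<sigma> < k \<longrightarrow> acyclic_over F (link \<Delta> \<sigma>))"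


section \<open>Boolean trees\<close>

text \<open>
  A poset is given as a subset \<open>P\<close> of an ordered type with the induced order. The face
  poset of a complex \<open>\<Delta>\<close> is \<open>\<Delta>\<close> itself, since the order on sets is inclusion.
\<close>

definition covers :: "'b::order set \<Rightarrow> 'b \<Rightarrow> 'b \<Rightarrow> bool" where
  "covers P y x \<longleftrightarrow> x \<in> P \<and> y \<in> P \<and> x < y \<and> \<not> (\<exists>z\<in>P. x < z \<and> z < y)"

definition minimal_elements :: "'b::order set \<Rightarrow> 'b set" where
  "minimal_elements T = {r \<in> T. \<not> (\<exists>x\<in>T. x < r)}"

inductive boolean_tree :: "'b::order set \<Rightarrow> nat \<Rightarrow> 'b set \<Rightarrow> bool" for P where
  single: "x \<in> P \<Longrightarrow> boolean_tree P 0 {x}"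
| join: "\<lbrakk>boolean_tree P i T1; boolean_tree P i T2; T1 \<inter> T2 = {};
          minimal_elements T1 = {r1}; minimal_elements T2 = {r2}; covers P r2 r1\<rbrakk>
         \<Longrightarrow> boolean_tree P (Suc i) (T1 \<union> T2)"

lemma boolean_tree_unique_minimal:
  assumes "boolean_tree P i T"
  shows "\<exists>r. minimal_elements T = {r} \<and> (\<forall>x\<in>T. r \<le> x)"
  using assms
proof induction
  case (single x)
  then show ?case by (auto simp: minimal_elements_def)
next
  case (join i T1 T2 r1 r2)
  have "\<forall>x\<in>T1. r1 \<le> x" "\<forall>x\<in>T2. r2 \<le> x" "r1 \<in> T1" "r1 < r2"
    using join by (auto simp: minimal_elements_def covers_def)
  then have least: "\<forall>x\<in>T1 \<union> T2. r1 \<le> x" and "r1 \<in> T1 \<union> T2"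
    by (auto intro: order.trans less_imp_le)
  then have "minimal_elements (T1 \<union> T2) = {r1}"
    unfolding minimal_elements_def by (auto simp: less_le_not_le dest: order.antisym)
  with least show ?case by blast
qed

end

theory Submission
  imports Defs "HOL-Algebra.Algebraic_Closure_Type" "HOL-Library.Function_Algebras"
    "HOL-Library.Nat_Bijection"
begin

section \<open>Idea of the proof\<close>

text \<open>
  Let \<open>K\<close> be the algebraic closure of the ground field. On the \<open>K\<close>-valued functions \<open>V\<close> on the
  faces of \<open>\<Delta>\<close>, a linear form \<open>\<Sum>v. q v \<cdot> e\<^sub>v\<close> of the exterior face ring acts by multiplication,
  \<open>wedge q\<close>; for \<open>q = 1\<close> this is the simplicial coboundary. If \<open>\<Delta>\<close> is \<open>k\<close>-fold acyclic, then
  \<open>wedge q\<close> is exact (kernel equals image) as soon as \<open>q\<close> vanishes at fewer than \<open>k\<close> vertices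
  (\<open>k_fold_wedge_exact\<close>).

  Give the vertices distinct values \<open>c v \<in> K\<close> and let \<open>\<theta>\<^sub>i\<close> have the weights \<open>(c v) ^ i\<close>, for
  \<open>i < k\<close>. A linear combination of the \<open>\<theta>\<^sub>i\<close> has weights \<open>p (c v)\<close> for a polynomial \<open>p\<close> of degree
  less than \<open>k\<close>. If \<open>p \<noteq> 0\<close>, then at most \<open>k - 1\<close> weights vanish, so every nonzero combination is
  exact. Over an algebraically closed field this forces the \<open>\<theta>\<^sub>i\<close> to be a regular sequence: with
  \<open>J\<^sub>i = \<theta>\<^sub>0 V + \<dots> + \<theta>\<^sub>i\<^sub>-\<^sub>1 V\<close>, the operator \<open>\<theta>\<^sub>i\<close> is exact on \<open>V / J\<^sub>i\<close>
  (\<open>exact_mod_add_image\<close>).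

  The faces that are not leading faces of elements of \<open>J\<^sub>k\<close> form a basis \<open>S\<close> of \<open>V / J\<^sub>k\<close>, and \<open>S\<close> is
  a subcomplex because \<open>J\<^sub>k\<close> is an ideal (\<open>standard_faces\<close>). If a set \<open>A\<close> of faces is a basis of
  \<open>V / J\<^sub>i\<^sub>+\<^sub>1\<close>, exactness makes \<open>A\<close> together with \<open>\<theta>\<^sub>i A\<close> a basis of \<open>V / J\<^sub>i\<close>. Since \<open>\<theta>\<^sub>i \<sigma>\<close> is a
  combination of faces covering \<open>\<sigma>\<close>, the exchange lemma replaces it by one such face \<open>f \<sigma>\<close>, and
  \<open>A \<union> f ` A\<close> is a basis of \<open>V / J\<^sub>i\<close> (\<open>basis_mod_double_faces\<close>). After \<open>k\<close> doublings the result is a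
  basis of \<open>V\<close> consisting of faces, which must be all of \<open>\<Delta>\<close>. Each doubling attaches a new leaf
  \<open>f \<sigma>\<close> above every \<open>\<sigma>\<close>, and this turns boolean trees of rank \<open>i\<close> into boolean trees of rank
  \<open>i + 1\<close> with the same minimal elements (\<open>boolean_tree_grow\<close>). So \<open>\<Delta>\<close> is partitioned into boolean
  trees of rank \<open>k\<close> whose minimal elements form \<open>S\<close>.
\<close>

section \<open>Linear algebra modulo a subspace\<close>

text \<open>
  Quotients \<open>V / J\<close> are handled through representatives in \<open>V\<close>, so that a whole chain of quotients
  lives in one type; \<open>exact_mod J f\<close> says that kernel and image of \<open>f\<close> agree on \<open>V / J\<close> when \<open>f\<close>
  squares to zero, and \<open>add_image J f\<close> is \<open>J + f V\<close>.
\<close>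

locale quotient_space = vector_space scale
  for scale :: "'a::field \<Rightarrow> 'b::ab_group_add \<Rightarrow> 'b" (infixr "*s" 75)
begin

definition exact_mod :: "'b set \<Rightarrow> ('b \<Rightarrow> 'b) \<Rightarrow> bool" where
  "exact_mod J f \<longleftrightarrow> (\<forall>x. f x \<in> J \<longrightarrow> (\<exists>y. x - f y \<in> J))"

definition add_image :: "'b set \<Rightarrow> ('b \<Rightarrow> 'b) \<Rightarrow> 'b set" where
  "add_image J f = {x. \<exists>y. x - f y \<in> J}"

definition basis_mod :: "'b set \<Rightarrow> 'i set \<Rightarrow> ('i \<Rightarrow> 'b) \<Rightarrow> bool" where
  "basis_mod J A u \<longleftrightarrow> finite A
     \<and> (\<forall>a. (\<Sum>i\<in>A. a i *s u i) \<in> J \<longrightarrow> (\<forall>i\<in>A. a i = 0))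
     \<and> (\<forall>x. \<exists>a. x - (\<Sum>i\<in>A. a i *s u i) \<in> J)"

lemma subspace_add_image:
  assumes "subspace J" "Vector_Spaces.linear scale scale f"
  shows "subspace (add_image J f)"
proof -
  interpret f: Vector_Spaces.linear scale scale f by fact
  show ?thesis
  proof (rule subspaceI)
    show "0 \<in> add_image J f"
      using assms(1) by (auto simp: add_image_def subspace_0 intro!: exI[of _ 0])
  next
    fix x y assume "x \<in> add_image J f" "y \<in> add_image J f"
    then obtain x' y' where "x - f x' \<in> J" "y - f y' \<in> J" by (auto simp: add_image_def)
    from subspace_add[OF assms(1) this]
    have "(x + y) - f (x' + y') \<in> J" by (simp add: f.add algebra_simps)
    then show "x + y \<in> add_image J f" by (auto simp: add_image_def)
  next
    fix c x assume "x \<in> add_image J f"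
    then obtain x' where "x - f x' \<in> J" by (auto simp: add_image_def)
    from subspace_scale[OF assms(1) this, of c]
    have "c *s x - f (c *s x') \<in> J" by (simp add: f.scale scale_right_diff_distrib)
    then show "c *s x \<in> add_image J f" by (auto simp: add_image_def)
  qed
qed

lemma add_image_superset:
  assumes "Vector_Spaces.linear scale scale f" "x \<in> J"
  shows "x \<in> add_image J f"
proof -
  interpret f: Vector_Spaces.linear scale scale f by fact
  show ?thesis using assms(2) by (auto simp: add_image_def intro!: exI[of _ 0])
qed

text \<open>
  The form in which finite dimension of \<open>V / I\<close> is used. It is proved by removing one element \<open>b\<close>
  of \<open>B\<close> at a time: either some initial part of the sequence already generates \<open>b\<close> modulo the rest,
  and is moved into \<open>I\<close>, or, by exchange, the sequence never involves \<open>b\<close>.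
\<close>

lemma no_infinite_independent_sequence:
  assumes "finite B" "\<And>n. x n \<in> span (B \<union> I)"
  shows "\<exists>n. x n \<in> span (I \<union> x ` {..<n::nat})"
  using assms
proof (induction B arbitrary: I x rule: finite_induct)
  case empty
  then show ?case by (intro exI[of _ 0]) auto
next
  case (insert b B)
  show ?case
  proof (cases "\<exists>n. b \<in> span (B \<union> (I \<union> x ` {..<n}))")
    case True
    then obtain n where n: "b \<in> span (B \<union> (I \<union> x ` {..<n}))" by auto
    have "span (insert b B \<union> I) \<subseteq> span (B \<union> (I \<union> x ` {..<n}))"
      by (rule span_minimal) (use n in \<open>auto intro: span_base\<close>)
    with insert.prems have "\<And>i. x (n + i) \<in> span (B \<union> (I \<union> x ` {..<n}))" by blast
    from insert.IH[of "\<lambda>i. x (n + i)", OF this]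
    obtain m where m: "x (n + m) \<in> span (I \<union> x ` {..<n} \<union> (\<lambda>i. x (n + i)) ` {..<m})" by auto
    have "I \<union> x ` {..<n} \<union> (\<lambda>i. x (n + i)) ` {..<m} \<subseteq> I \<union> x ` {..<n + m}" by auto
    with m span_mono show ?thesis by blast
  next
    case False
    have "x n \<in> span (B \<union> I)" for n
    proof (induction n rule: less_induct)
      case (less n)
      let ?S = "B \<union> (I \<union> x ` {..<n})"
      have "x n \<in> span (insert b ?S)"
        using insert.prems[of n] span_mono[of "insert b B \<union> I" "insert b ?S"] by auto
      moreover have "b \<notin> span (insert (x n) ?S)"
      proof -
        have "insert (x n) ?S = B \<union> (I \<union> x ` {..<Suc n})" by (auto simp: lessThan_Suc)
        with False show ?thesis by metis
      qed
      ultimately have "x n \<in> span ?S" using in_span_insert by blast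
      moreover have "span ?S \<subseteq> span (B \<union> I)"
        by (rule span_minimal) (use less in \<open>auto intro: span_base\<close>)
      ultimately show ?case by blast
    qed
    from insert.IH[OF this] show ?thesis .
  qed
qed

lemma span_image_Un_subspace_iff:
  assumes J: "subspace J" and A: "finite A"
  shows "y \<in> span (u ` A \<union> J) \<longleftrightarrow> (\<exists>a. y - (\<Sum>i\<in>A. a i *s u i) \<in> J)"
proof
  assume "y \<in> span (u ` A \<union> J)"
  then show "\<exists>a. y - (\<Sum>i\<in>A. a i *s u i) \<in> J"
  proof (rule span_induct)
    fix y assume "y \<in> u ` A \<union> J"
    then show "\<exists>a. y - (\<Sum>i\<in>A. a i *s u i) \<in> J"
    proof
      assume "y \<in> u ` A"
      then obtain i where i: "i \<in> A" "y = u i" by auto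
      have "(\<Sum>j\<in>A. (if j = i then 1 else 0) *s u j) = u i"
        using i A by (simp add: if_distrib[of "\<lambda>c. c *s _"] sum.delta cong: if_cong)
      with i J show ?thesis by (intro exI[of _ "\<lambda>j. if j = i then 1 else 0"]) (auto simp: subspace_0)
    qed (auto intro!: exI[of _ "\<lambda>_. 0"])
  next
    show "subspace {y. \<exists>a. y - (\<Sum>i\<in>A. a i *s u i) \<in> J}"
    proof (rule subspaceI; clarsimp)
      show "\<exists>a. - (\<Sum>i\<in>A. a i *s u i) \<in> J"
        using J by (intro exI[of _ "\<lambda>_. 0"]) (auto simp: subspace_0)
    next
      fix y z a b assume "y - (\<Sum>i\<in>A. a i *s u i) \<in> J" "z - (\<Sum>i\<in>A. b i *s u i) \<in> J"
      from subspace_add[OF J this] show "\<exists>a. y + z - (\<Sum>i\<in>A. a i *s u i) \<in> J"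
        by (intro exI[of _ "\<lambda>i. a i + b i"]) (simp add: scale_left_distrib sum.distrib algebra_simps)
    next
      fix c y a assume "y - (\<Sum>i\<in>A. a i *s u i) \<in> J"
      from subspace_scale[OF J this, of c] show "\<exists>a. c *s y - (\<Sum>i\<in>A. a i *s u i) \<in> J"
        by (intro exI[of _ "\<lambda>i. c * a i"])
          (simp add: scale_right_diff_distrib scale_sum_right)
    qed
  qed
next
  assume "\<exists>a. y - (\<Sum>i\<in>A. a i *s u i) \<in> J"
  then obtain a where a: "y - (\<Sum>i\<in>A. a i *s u i) \<in> J" ..
  have "(y - (\<Sum>i\<in>A. a i *s u i)) + (\<Sum>i\<in>A. a i *s u i) \<in> span (u ` A \<union> J)"
    by (intro span_add span_sum span_scale) (use a in \<open>auto intro: span_base\<close>)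
  then show "y \<in> span (u ` A \<union> J)" by simp
qed

lemma polynomial_relation:
  assumes J: "subspace J" and B: "finite B" "span (B \<union> J) = UNIV"
  shows "\<exists>p. p \<noteq> 0 \<and> (\<Sum>i\<le>degree p. coeff p i *s x i) \<in> J"
proof -
  obtain n where "x n \<in> span (J \<union> x ` {..<n::nat})"
    using no_infinite_independent_sequence[of B x J] B by auto
  then obtain a where a: "x n - (\<Sum>i<n. a i *s x i) \<in> J"
    using span_image_Un_subspace_iff[OF J finite_lessThan[of n]] by (metis Un_commute)
  define p where "p = monom 1 n - (\<Sum>i<n. monom (a i) i)"
  have c: "coeff p j = (if j = n then 1 else if j < n then - a j else 0)" for j
    by (auto simp: p_def coeff_sum sum.delta)
  have d: "degree p = n"
    by (rule antisym) (auto intro!: degree_le le_degree simp: c)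
  have "(\<Sum>i\<le>n. coeff p i *s x i) = x n - (\<Sum>i<n. a i *s x i)"
    by (simp add: lessThan_Suc_atMost[symmetric] c sum_negf)
  with a d have "p \<noteq> 0 \<and> (\<Sum>i\<le>degree p. coeff p i *s x i) \<in> J" using c[of n] by auto
  then show ?thesis by blast
qed

text \<open>
  Some \<open>g t\<close> must have a nonzero \<open>u i\<close>-coordinate, since otherwise \<open>u i\<close> would be a combination of
  the other basis vectors; that \<open>g t\<close> can take the place of \<open>u i\<close>.
\<close>

lemma basis_mod_exchange:
  assumes J: "subspace J" and b: "basis_mod J A u" and i: "i \<in> A" and W: "finite W"
    and u: "u i - (\<Sum>t\<in>W. b t *s g t) \<in> J"
  shows "\<exists>t\<in>W. basis_mod J A (u(i := g t))"
proof -
  have A: "finite A" and ind: "\<And>a j. (\<Sum>i\<in>A. a i *s u i) \<in> J \<Longrightarrow> j \<in> A \<Longrightarrow> a j = 0"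
    and sp: "\<And>x. \<exists>a. x - (\<Sum>i\<in>A. a i *s u i) \<in> J"
    using b unfolding basis_mod_def by blast+
  obtain m where m: "\<And>t. g t - (\<Sum>j\<in>A. m t j *s u j) \<in> J" using sp[of "g _"] by metis
  have "\<exists>t\<in>W. m t i \<noteq> 0"
  proof (rule ccontr)
    assume "\<not> ?thesis"
    then have 0: "\<And>t. t \<in> W \<Longrightarrow> m t i = 0" by blast
    have "(\<Sum>t\<in>W. b t *s (g t - (\<Sum>j\<in>A. m t j *s u j))) \<in> J"
      by (intro subspace_sum[OF J] subspace_scale[OF J] m)
    from subspace_add[OF J u this]
    have "u i - (\<Sum>t\<in>W. \<Sum>j\<in>A. (b t * m t j) *s u j) \<in> J"
      by (simp add: scale_right_diff_distrib sum_subtractf scale_sum_right)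
    also have "u i - (\<Sum>t\<in>W. \<Sum>j\<in>A. (b t * m t j) *s u j) =
      (\<Sum>j\<in>A. ((if j = i then 1 else 0) - (\<Sum>t\<in>W. b t * m t j)) *s u j)"
      using A i
      by (subst sum.swap)
        (simp add: scale_left_diff_distrib sum_subtractf scale_sum_left
          if_distrib[of "\<lambda>c. c *s _"] sum.delta cong: if_cong)
    finally show False using ind[OF _ i] 0 by fastforce
  qed
  then obtain t where t: "t \<in> W" "m t i \<noteq> 0" by blast
  define v where "v = u(i := g t)"
  define B where "B = A - {i}"
  have B: "finite B" "A = insert i B" "i \<notin> B" using A i by (auto simp: B_def)
  have vB: "(\<Sum>j\<in>B. a j *s v j) = (\<Sum>j\<in>B. a j *s u j)" for a
    by (rule sum.cong) (auto simp: v_def B)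
  have vi: "v i = g t" by (simp add: v_def)
  have gt: "g t - (m t i *s u i + (\<Sum>j\<in>B. m t j *s u j)) \<in> J" using m[of t] B by simp
  have "basis_mod J A v" unfolding basis_mod_def
  proof (intro conjI allI impI ballI)
    fix a j assume a: "(\<Sum>i\<in>A. a i *s v i) \<in> J" and j: "j \<in> A"
    have "(\<Sum>j\<in>A. a j *s v j) - a i *s (g t - (m t i *s u i + (\<Sum>j\<in>B. m t j *s u j))) \<in> J"
      by (intro subspace_diff[OF J] subspace_scale[OF J] a gt)
    also have "(\<Sum>j\<in>A. a j *s v j) - a i *s (g t - (m t i *s u i + (\<Sum>j\<in>B. m t j *s u j)))
       = (\<Sum>j\<in>A. (if j = i then a i * m t i else a j + a i * m t j) *s u j)"
    proof -
      have "(\<Sum>j\<in>B. (if j = i then a i * m t i else a j + a i * m t j) *s u j)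
        = (\<Sum>j\<in>B. (a j + a i * m t j) *s u j)" by (rule sum.cong) (use B in auto)
      then show ?thesis using B
        by (simp add: vB vi scale_right_diff_distrib scale_left_distrib scale_right_distrib
            sum.distrib scale_sum_right)
    qed
    finally have *: "(\<Sum>j\<in>A. (if j = i then a i * m t i else a j + a i * m t j) *s u j) \<in> J" .
    from ind[OF *, of i] t i have "a i = 0" by simp
    with ind[OF *, of j] j show "a j = 0" by (auto split: if_splits)
  next
    fix x
    from sp obtain a where a: "x - (\<Sum>i\<in>A. a i *s u i) \<in> J" by blast
    define r where "r = a i / m t i"
    have r: "r * m t i = a i" using t by (simp add: r_def)
    have "x - (\<Sum>i\<in>A. a i *s u i) - r *s (g t - (m t i *s u i + (\<Sum>j\<in>B. m t j *s u j))) \<in> J"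
      by (intro subspace_diff[OF J] subspace_scale[OF J] a gt)
    also have "x - (\<Sum>i\<in>A. a i *s u i) - r *s (g t - (m t i *s u i + (\<Sum>j\<in>B. m t j *s u j)))
      = x - (\<Sum>j\<in>A. (if j = i then r else a j - r * m t j) *s v j)"
    proof -
      have "(\<Sum>j\<in>B. (if j = i then r else a j - r * m t j) *s v j)
        = (\<Sum>j\<in>B. (a j - r * m t j) *s u j)" by (rule sum.cong) (use B in \<open>auto simp: v_def\<close>)
      then show ?thesis using B
        by (simp add: vi scale_right_diff_distrib scale_left_diff_distrib scale_right_distrib
            sum_subtractf scale_sum_right r)
    qed
    finally show "\<exists>a. x - (\<Sum>j\<in>A. a j *s v j) \<in> J"
      by (rule exI[of _ "\<lambda>j. if j = i then r else a j - r * m t j"])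
  qed (use A in auto)
  with t show ?thesis by (auto simp: v_def)
qed

text \<open>
  By exactness \<open>f\<close> induces an isomorphism from \<open>V / (J + f V)\<close> onto \<open>(J + f V) / J\<close>, so a basis of the
  former and its image under \<open>f\<close> combine to a basis of \<open>V / J\<close>.
\<close>

lemma basis_mod_double:
  assumes J: "subspace J" and f: "Vector_Spaces.linear scale scale f"
    and fJ: "\<And>x. x \<in> J \<Longrightarrow> f x \<in> J" and ff: "\<And>x. f (f x) = 0"
    and ex: "exact_mod J f" and b: "basis_mod (add_image J f) S u"
  shows "basis_mod J (S <+> S) (case_sum u (\<lambda>s. f (u s)))"
proof -
  interpret f: Vector_Spaces.linear scale scale f by fact
  have S: "finite S" and ind: "\<And>a j. (\<Sum>i\<in>S. a i *s u i) \<in> add_image J f \<Longrightarrow> j \<in> S \<Longrightarrow> a j = 0"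
    and sp: "\<And>x. \<exists>a. x - (\<Sum>i\<in>S. a i *s u i) \<in> add_image J f"
    using b unfolding basis_mod_def by blast+
  have ker: "x \<in> add_image J f" if "f x \<in> J" for x
    using ex that by (auto simp: exact_mod_def add_image_def)
  have sum2: "(\<Sum>i\<in>S <+> S. a i *s case_sum u (\<lambda>s. f (u s)) i)
     = (\<Sum>s\<in>S. a (Inl s) *s u s) + f (\<Sum>s\<in>S. a (Inr s) *s u s)" for a
    using S by (simp add: sum.Plus f.sum f.scale)
  show ?thesis unfolding basis_mod_def sum2
  proof (intro conjI allI impI ballI)
    fix a j assume a: "(\<Sum>s\<in>S. a (Inl s) *s u s) + f (\<Sum>s\<in>S. a (Inr s) *s u s) \<in> J"
      and j: "j \<in> S <+> S"
    have "(\<Sum>s\<in>S. a (Inl s) *s u s) \<in> add_image J f"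
      using a by (auto simp: add_image_def intro!: exI[of _ "- (\<Sum>s\<in>S. a (Inr s) *s u s)"] simp: f.neg)
    from ind[OF this] have 1: "\<And>s. s \<in> S \<Longrightarrow> a (Inl s) = 0" .
    with a have "f (\<Sum>s\<in>S. a (Inr s) *s u s) \<in> J" by simp
    from ind[OF ker[OF this]] have 2: "\<And>s. s \<in> S \<Longrightarrow> a (Inr s) = 0" .
    from 1 2 j show "a j = 0" by auto
  next
    fix x
    from sp obtain a where "x - (\<Sum>i\<in>S. a i *s u i) \<in> add_image J f" by blast
    then obtain y where y: "x - (\<Sum>i\<in>S. a i *s u i) - f y \<in> J" by (auto simp: add_image_def)
    from sp obtain b where "y - (\<Sum>i\<in>S. b i *s u i) \<in> add_image J f" by blast
    then obtain z where "y - (\<Sum>i\<in>S. b i *s u i) - f z \<in> J" by (auto simp: add_image_def)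
    from subspace_add[OF J y fJ[OF this]]
    have "x - ((\<Sum>i\<in>S. a i *s u i) + f (\<Sum>i\<in>S. b i *s u i)) \<in> J"
      by (simp add: f.diff f.add ff algebra_simps)
    then show "\<exists>a. x - ((\<Sum>s\<in>S. a (Inl s) *s u s) + f (\<Sum>s\<in>S. a (Inr s) *s u s)) \<in> J"
      by (intro exI[of _ "case_sum a b"]) simp
  qed (use S in simp)
qed

lemma basis_mod_reindex:
  assumes "inj_on h A" "basis_mod J A (\<lambda>i. u (h i))"
  shows "basis_mod J (h ` A) u"
proof -
  have A: "finite A" using assms(2) by (simp add: basis_mod_def)
  have *: "(\<Sum>i\<in>h ` A. a i *s u i) = (\<Sum>i\<in>A. a (h i) *s u (h i))" for a
    using assms(1) by (simp add: sum.reindex)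
  show ?thesis unfolding basis_mod_def *
  proof (intro conjI allI impI ballI)
    fix a j assume a: "(\<Sum>i\<in>A. a (h i) *s u (h i)) \<in> J" and "j \<in> h ` A"
    then obtain i where "i \<in> A" "j = h i" by blast
    moreover have "\<And>b. (\<Sum>i\<in>A. b i *s u (h i)) \<in> J \<Longrightarrow> \<forall>i\<in>A. b i = 0"
      using assms(2) by (simp add: basis_mod_def)
    note this[of "\<lambda>i. a (h i)", OF a]
    ultimately show "a j = 0" by blast
  next
    fix x
    have "\<exists>a. x - (\<Sum>i\<in>A. a i *s u (h i)) \<in> J" using assms(2) unfolding basis_mod_def by iprover
    then obtain a where a: "x - (\<Sum>i\<in>A. a i *s u (h i)) \<in> J" by (rule exE)
    have "(\<Sum>i\<in>A. a (the_inv_into A h (h i)) *s u (h i)) = (\<Sum>i\<in>A. a i *s u (h i))"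
      using assms(1) by (intro sum.cong) (auto simp: the_inv_into_f_f)
    with a show "\<exists>a. x - (\<Sum>i\<in>A. a (h i) *s u (h i)) \<in> J"
      by (intro exI[of _ "\<lambda>j. a (the_inv_into A h j)"]) simp
  qed (use A in auto)
qed

lemma basis_mod_inj_on:
  assumes J: "subspace J" and b: "basis_mod J A u"
  shows "inj_on u A"
proof (rule inj_onI, rule ccontr)
  fix i j assume ij: "i \<in> A" "j \<in> A" "u i = u j" "i \<noteq> j"
  have A: "finite A" using b by (simp add: basis_mod_def)
  let ?a = "\<lambda>l. (if l = i then 1 else 0) - (if l = j then 1 else (0::'a))"
  have "(\<Sum>l\<in>A. ?a l *s u l) = 0" using A ij
    by (simp add: scale_left_diff_distrib sum_subtractf if_distrib[of "\<lambda>c. c *s _"] sum.delta cong: if_cong)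
  then have "(\<Sum>l\<in>A. ?a l *s u l) \<in> J" using J by (simp only: subspace_0)
  moreover
  have "\<And>a. (\<Sum>l\<in>A. a l *s u l) \<in> J \<Longrightarrow> a i = 0"
    using b ij by (auto simp only: basis_mod_def)
  from this[of ?a] calculation have "?a i = 0" by blast
  with ij show False by simp
qed

text \<open>
  A two-operator case of Dade's lemma. Let \<open>Z\<close> be the space of all \<open>x\<close> with \<open>g x \<in> J + f V\<close> and \<open>I = J + f V + g V\<close>.
  Sending \<open>x \<in> Z\<close> to a solution \<open>w\<close> of \<open>f w = g x\<close> modulo \<open>J\<close> induces an endomorphism of \<open>Z / I\<close>. If \<open>Z / I\<close>
  were nonzero, this endomorphism would have an eigenvector \<open>y\<close> with some eigenvalue \<open>l\<close>, and then
  a suitable \<open>y + f v\<close> would be annihilated by \<open>g - l f\<close> modulo \<open>J\<close>. Exactness of \<open>g - l f\<close> would put \<open>y\<close> into \<open>I\<close>.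
\<close>

lemma exact_mod_add_image:
  fixes f g :: "'b \<Rightarrow> 'b"
  assumes root: "\<And>p::'a poly. degree p > 0 \<Longrightarrow> \<exists>l. poly p l = 0"
    and J: "subspace J" and B: "finite B" "span (B \<union> J) = UNIV"
    and f: "Vector_Spaces.linear scale scale f" and g: "Vector_Spaces.linear scale scale g"
    and fJ: "\<And>x. x \<in> J \<Longrightarrow> f x \<in> J" and gJ: "\<And>x. x \<in> J \<Longrightarrow> g x \<in> J"
    and ff: "\<And>x. f (f x) = 0" and gg: "\<And>x. g (g x) = 0" and fg: "\<And>x. f (g x) = - g (f x)"
    and exf: "exact_mod J f" and exg: "\<And>l. exact_mod J (\<lambda>x. g x - l *s f x)"
  shows "exact_mod (add_image J f) g"
proof -
  interpret f: Vector_Spaces.linear scale scale f by fact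
  interpret g: Vector_Spaces.linear scale scale g by fact
  define I where "I = add_image (add_image J f) g"
  have sI: "subspace I" by (simp add: I_def subspace_add_image J f g)
  have JI: "J \<subseteq> I" using f g by (auto simp: I_def intro!: add_image_superset)
  have I: "x \<in> I \<longleftrightarrow> (\<exists>u v. x - g v - f u \<in> J)" for x by (auto simp: I_def add_image_def)
  have exf': "\<exists>y. x - f y \<in> J" if "f x \<in> J" for x using exf that by (auto simp: exact_mod_def)
  show ?thesis
    unfolding exact_mod_def
  proof (intro allI impI)
    fix x assume x: "g x \<in> add_image J f"
    have "x \<in> I"
    proof (rule ccontr)
      assume xI: "x \<notin> I"
      have step: "\<exists>w'. g w - f w' \<in> J" if "g z - f w \<in> J" for z w
      proof -
        from gJ[OF that] have "f (g w) \<in> J" by (simp add: g.diff gg fg)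
        from exf'[OF this] show ?thesis .
      qed
      from x obtain w where w: "g x - f w \<in> J" by (auto simp: add_image_def)
      \<comment> \<open>Iterating the relation \<open>f w = g x\<close> gives a sequence that plays the role of the powers of the
        endomorphism applied to \<open>x\<close>, without choosing a linear solution map.\<close>
      define nx where "nx z = (SOME z'. g z - f z' \<in> J)" for z
      have nx: "g w - f (nx w) \<in> J" if "g z - f w \<in> J" for z w
        unfolding nx_def by (rule someI_ex) (rule step[OF that])
      define s where "s n = (case n of 0 \<Rightarrow> x | Suc m \<Rightarrow> (nx ^^ m) w)" for n
      have s0: "s 0 = x" by (simp add: s_def)
      have sS: "g (s n) - f (s (Suc n)) \<in> J" for n
        by (induction n) (use w nx in \<open>auto simp: s_def\<close>)
      \<comment> \<open>A relation of least degree, divided by a linear factor, applied to the sequence gives the eigenvector.\<close>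
      let ?P = "\<lambda>p::'a poly. p \<noteq> 0 \<and> (\<Sum>i\<le>degree p. coeff p i *s s i) \<in> I"
      have "span (B \<union> I) = UNIV" using B JI span_mono[of "B \<union> J" "B \<union> I"] by auto
      with polynomial_relation[OF sI B(1), of s] obtain p where "?P p" by blast
      then obtain p where p: "?P p" and min: "\<And>q. ?P q \<Longrightarrow> degree p \<le> degree q"
        using ex_has_least_nat[of ?P p degree] by auto
      have "degree p \<noteq> 0"
      proof
        assume d: "degree p = 0"
        then have "coeff p 0 *s x \<in> I" "coeff p 0 \<noteq> 0" using p s0 d leading_coeff_0_iff[of p] by simp_all
        from subspace_scale[OF sI this(1), of "inverse (coeff p 0)"] this(2) xI show False by simp
      qed
      with root obtain l where "poly p l = 0" by auto
      then obtain q where q: "p = [:- l, 1:] * q" by (auto simp: poly_eq_0_iff_dvd)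
      have q0: "q \<noteq> 0" using p q by auto
      have dp: "degree p = Suc (degree q)"
        unfolding q using q0 by (subst degree_mult_eq) auto
      define y where "y = (\<Sum>i\<le>degree q. coeff q i *s s i)"
      define y' where "y' = (\<Sum>i\<le>degree q. coeff q i *s s (Suc i))"
      have "y \<notin> I" using min[of q] q0 dp by (auto simp: y_def)
      have "(\<Sum>i\<le>degree q. coeff q i *s (g (s i) - f (s (Suc i)))) \<in> J"
        by (intro subspace_sum[OF J] subspace_scale[OF J] sS)
      then have gy: "g y - f y' \<in> J"
        by (simp add: y_def y'_def f.sum g.sum f.scale g.scale scale_right_diff_distrib sum_subtractf)
      have "(\<Sum>i\<le>degree p. coeff p i *s s i) = y' - l *s y"
      proof -
        have cp: "coeff p i = (case i of 0 \<Rightarrow> 0 | Suc j \<Rightarrow> coeff q j) - l * coeff q i" for i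
          unfolding q by (simp add: coeff_pCons algebra_simps split: nat.split)
        have "(\<Sum>i\<le>Suc (degree q). (case i of 0 \<Rightarrow> 0 | Suc j \<Rightarrow> coeff q j) *s s i) = y'"
          unfolding y'_def by (subst sum.atMost_Suc_shift) simp
        moreover have "(\<Sum>i\<le>Suc (degree q). (l * coeff q i) *s s i) = l *s y"
          by (simp add: y_def scale_sum_right coeff_eq_0)
        ultimately show ?thesis unfolding dp cp
          by (simp only: scale_left_diff_distrib sum_subtractf)
      qed
      with p have "y' - l *s y \<in> I" by simp
      then obtain u v where uv: "y' - l *s y - g v - f u \<in> J" by (auto simp: I)
      from subspace_add[OF J gy fJ[OF this]]
      have "g (y + f v) - l *s f (y + f v) \<in> J"
        by (simp add: f.diff f.scale f.add g.add ff fg scale_right_distrib algebra_simps)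
      with exg[of l] obtain z where "y + f v - (g z - l *s f z) \<in> J" by (auto simp: exact_mod_def)
      then have "y - g z - f (- v - l *s z) \<in> J" by (simp add: f.neg f.diff f.scale algebra_simps)
      with \<open>y \<notin> I\<close> show False by (auto simp: I)
    qed
    then show "\<exists>y. x - g y \<in> add_image J f" by (auto simp: I_def add_image_def)
  qed
qed

end


section \<open>Multiplication by linear forms in the exterior face ring\<close>

definition scale_fun :: "'k::field \<Rightarrow> ('i \<Rightarrow> 'k) \<Rightarrow> 'i \<Rightarrow> 'k" where
  "scale_fun c x = (\<lambda>i. c * x i)"

global_interpretation cochain: quotient_space "scale_fun :: 'k::field \<Rightarrow> ('i \<Rightarrow> 'k) \<Rightarrow> 'i \<Rightarrow> 'k"
  by unfold_locales (auto simp: scale_fun_def fun_eq_iff algebra_simps)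

lemma scale_fun_apply: "scale_fun c x i = c * x i"
  by (simp add: scale_fun_def)

definition orientation_sign :: "'a \<Rightarrow> 'a set \<Rightarrow> 'k::field" where
  "orientation_sign v \<tau> = (- 1) ^ card {u \<in> \<tau>. vertex_less u v}"

text \<open>
  Multiplication by \<open>\<Sum>v. q v \<cdot> e\<^sub>v\<close>, where the function \<open>x\<close> stands for \<open>\<Sum>\<tau>. x \<tau> \<cdot> e\<^sub>\<tau>\<close>. It acts on functions on
  all vertex sets, whatever the complex is; the complex enters by computing modulo the functions that
  vanish on its faces. On infinite sets the value is the default \<open>0\<close> of an infinite sum.
\<close>

definition wedge :: "('a \<Rightarrow> 'k) \<Rightarrow> ('a set \<Rightarrow> 'k) \<Rightarrow> 'a set \<Rightarrow> 'k::field" where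
  "wedge q x = (\<lambda>\<tau>. \<Sum>v\<in>\<tau>. q v * orientation_sign v \<tau> * x (\<tau> - {v}))"

lemma vertex_less_linear:
  shows "vertex_less u v \<Longrightarrow> \<not> vertex_less v u" "u \<noteq> v \<Longrightarrow> vertex_less u v \<or> vertex_less v u"
  using well_order_on_vertex_order[where 'a='a]
  by (auto simp: vertex_less_def well_order_on_def linear_order_on_def partial_order_on_def
      antisym_def total_on_def)

lemma orientation_sign_nonzero [simp]: "orientation_sign v \<tau> \<noteq> 0"
  by (simp add: orientation_sign_def)

lemma orientation_sign_swap:
  assumes "finite \<tau>" "v \<in> \<tau>" "w \<in> \<tau>" "v \<noteq> w"
  shows "orientation_sign v \<tau> * orientation_sign w (\<tau> - {v}) =
       - (orientation_sign w \<tau> * orientation_sign v (\<tau> - {w}) :: 'k::field)"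
proof -
  have *: "orientation_sign w (\<tau> - {v}) = - (orientation_sign w \<tau> :: 'k)"
      "orientation_sign v (\<tau> - {w}) = (orientation_sign v \<tau> :: 'k)"
    if "finite \<tau>" "v \<in> \<tau>" "vertex_less v w" for v w
  proof -
    have "{u \<in> \<tau>. vertex_less u w} = insert v {u \<in> \<tau> - {v}. vertex_less u w}" using that by auto
    then have "card {u \<in> \<tau>. vertex_less u w} = Suc (card {u \<in> \<tau> - {v}. vertex_less u w})"
      using that(1) by simp
    then show "orientation_sign w (\<tau> - {v}) = - (orientation_sign w \<tau> :: 'k)"
      by (simp add: orientation_sign_def)
    have "{u \<in> \<tau> - {w}. vertex_less u v} = {u \<in> \<tau>. vertex_less u v}"
      using vertex_less_linear(1)[OF that(3)] by auto
    then show "orientation_sign v (\<tau> - {w}) = (orientation_sign v \<tau> :: 'k)"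
      by (simp add: orientation_sign_def)
  qed
  from vertex_less_linear(2)[OF assms(4)] show ?thesis
    using *[of v w] *[of w v] assms by auto
qed

lemma sum_antisymmetric_pairs:
  fixes F :: "'a \<Rightarrow> 'a \<Rightarrow> 'k::ab_group_add"
  assumes "finite A" "\<And>v w. v \<in> A \<Longrightarrow> w \<in> A \<Longrightarrow> v \<noteq> w \<Longrightarrow> F v w = - F w v"
  shows "(\<Sum>v\<in>A. \<Sum>w\<in>A - {v}. F v w) = 0"
  using assms
proof (induction A rule: finite_induct)
  case (insert a A)
  have "(\<Sum>v\<in>A. \<Sum>w\<in>insert a A - {v}. F v w) = (\<Sum>v\<in>A. F v a + (\<Sum>w\<in>A - {v}. F v w))"
  proof (rule sum.cong)
    fix v assume "v \<in> A"
    then have "insert a A - {v} = insert a (A - {v})" using insert.hyps by auto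
    then show "(\<Sum>w\<in>insert a A - {v}. F v w) = F v a + (\<Sum>w\<in>A - {v}. F v w)"
      using insert.hyps by simp
  qed simp
  moreover have "(\<Sum>w\<in>A. F a w) = (\<Sum>w\<in>A. - F w a)"
    by (rule sum.cong[OF refl]) (rule insert.prems, use insert.hyps in auto)
  moreover have "(\<Sum>v\<in>A. \<Sum>w\<in>A - {v}. F v w) = 0"
    by (rule insert.IH) (rule insert.prems, auto)
  ultimately show ?case using insert.hyps by (simp add: sum.distrib sum_negf)
qed simp

lemma wedge_self: "wedge q (wedge q x) = 0"
proof
  fix \<tau>
  show "wedge q (wedge q x) \<tau> = 0 \<tau>"
  proof (cases "finite \<tau>")
    case True
    have "wedge q (wedge q x) \<tau> = (\<Sum>v\<in>\<tau>. \<Sum>w\<in>\<tau> - {v}. q v * q w *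
       (orientation_sign v \<tau> * orientation_sign w (\<tau> - {v})) * x (\<tau> - {v} - {w}))"
      by (simp add: wedge_def sum_distrib_left algebra_simps)
    also have "\<dots> = 0"
    proof (rule sum_antisymmetric_pairs[OF True])
      fix v w assume vw: "v \<in> \<tau>" "w \<in> \<tau>" "v \<noteq> w"
      have "\<tau> - {v} - {w} = \<tau> - {w} - {v}" by blast
      then show "q v * q w * (orientation_sign v \<tau> * orientation_sign w (\<tau> - {v})) * x (\<tau> - {v} - {w})
        = - (q w * q v * (orientation_sign w \<tau> * orientation_sign v (\<tau> - {w})) * x (\<tau> - {w} - {v}))"
        unfolding orientation_sign_swap[OF True vw] by simp
    qed
    finally show ?thesis by simp
  qed (simp add: wedge_def)
qed

lemma wedge_add: "wedge q (x + y) = wedge q x + wedge q y"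
  by (rule ext) (simp add: wedge_def distrib_left sum.distrib)

lemma wedge_diff: "wedge q (x - y) = wedge q x - wedge q y"
  by (rule ext) (simp add: wedge_def right_diff_distrib sum_subtractf)

lemma wedge_zero: "wedge q 0 = 0"
  by (rule ext) (simp add: wedge_def)

lemma wedge_scale: "wedge q (scale_fun c x) = scale_fun c (wedge q x)"
  by (rule ext) (simp add: wedge_def scale_fun_def sum_distrib_left mult.left_commute)

lemma wedge_add_weights: "wedge (\<lambda>v. p v + q v) x = wedge p x + wedge q x"
  by (rule ext) (simp add: wedge_def distrib_right sum.distrib)

lemma linear_wedge: "Vector_Spaces.linear scale_fun scale_fun (wedge q)"
  by unfold_locales (simp_all only: wedge_add wedge_scale)

text \<open>
  Polarisation of \<open>wedge_self\<close>.
\<close>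

lemma wedge_anticommute: "wedge p (wedge q x) = - wedge q (wedge p x)"
proof -
  have "wedge (\<lambda>v. p v + q v) (wedge (\<lambda>v. p v + q v) x) = 0" by (rule wedge_self)
  then have "wedge p (wedge q x) + wedge q (wedge p x) = 0"
    by (simp add: wedge_add_weights wedge_add wedge_self)
  then show ?thesis by (simp only: eq_neg_iff_add_eq_0)
qed

definition vanishing :: "'a set set \<Rightarrow> ('a set \<Rightarrow> 'k::field) set" where
  "vanishing \<Delta> = {x. \<forall>\<tau>\<in>\<Delta>. x \<tau> = 0}"

definition wedge_exact :: "'a set set \<Rightarrow> ('a \<Rightarrow> 'k::field) \<Rightarrow> bool" where
  "wedge_exact \<Delta> q \<longleftrightarrow>
     (\<forall>x. (\<forall>\<tau>\<in>\<Delta>. wedge q x \<tau> = 0) \<longrightarrow> (\<exists>y. \<forall>\<tau>\<in>\<Delta>. x \<tau> = wedge q y \<tau>))"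

lemma wedge_exact_iff: "wedge_exact \<Delta> q \<longleftrightarrow> cochain.exact_mod (vanishing \<Delta>) (wedge q)"
  unfolding wedge_exact_def cochain.exact_mod_def vanishing_def mem_Collect_eq minus_apply
    right_minus_eq by (rule refl)

section \<open>Acyclicity as exactness over the algebraic closure\<close>

definition incidence :: "'a set \<Rightarrow> 'a set \<Rightarrow> 'k::field" where
  "incidence \<sigma> \<tau> = (\<Sum>v\<in>\<sigma>. if \<tau> = \<sigma> - {v} then orientation_sign v \<sigma> else 0)"

lemma boundary_incidence: "boundary \<Gamma> c \<tau> = (\<Sum>\<sigma>\<in>\<Gamma>. c \<sigma> * incidence \<sigma> \<tau>)"
  unfolding boundary_def incidence_def orientation_sign_def sum_distrib_left
  by (intro sum.cong refl) simp

text \<open>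
  Together with \<open>boundary_incidence\<close>, this shows that \<open>wedge (\<lambda>_. 1)\<close> is the transpose of the boundary map.
\<close>

lemma wedge_incidence:
  assumes "finite \<Gamma>" "\<And>\<sigma> \<tau>. \<sigma> \<in> \<Gamma> \<Longrightarrow> \<tau> \<subseteq> \<sigma> \<Longrightarrow> \<tau> \<in> \<Gamma>" "\<sigma> \<in> \<Gamma>"
  shows "wedge (\<lambda>_. 1) x \<sigma> = (\<Sum>\<tau>\<in>\<Gamma>. incidence \<sigma> \<tau> * x \<tau>)"
proof -
  have "(\<Sum>\<tau>\<in>\<Gamma>. incidence \<sigma> \<tau> * x \<tau>) =
     (\<Sum>v\<in>\<sigma>. \<Sum>\<tau>\<in>\<Gamma>. if \<tau> = \<sigma> - {v} then orientation_sign v \<sigma> * x \<tau> else 0)"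
    unfolding incidence_def sum_distrib_right
    by (subst sum.swap) (intro sum.cong refl, simp)
  also have "\<dots> = (\<Sum>v\<in>\<sigma>. orientation_sign v \<sigma> * x (\<sigma> - {v}))"
  proof (rule sum.cong)
    fix v assume "v \<in> \<sigma>"
    have "\<sigma> - {v} \<in> \<Gamma>" using assms by blast
    then show "(\<Sum>\<tau>\<in>\<Gamma>. if \<tau> = \<sigma> - {v} then orientation_sign v \<sigma> * x \<tau> else 0) =
        orientation_sign v \<sigma> * x (\<sigma> - {v})"
      using assms(1) by (simp add: sum.delta)
  qed simp
  finally show ?thesis by (simp add: wedge_def)
qed

lemma acyclic_cycle_is_boundary:
  fixes c :: "'a set \<Rightarrow> 'f::field"
  assumes "acyclic_over TYPE('f) \<Gamma>" "- 1 \<le> p" "c \<in> cycles p \<Gamma>"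
  shows "\<exists>d\<in>chains (p + 1) \<Gamma>. boundary \<Gamma> d = c"
proof -
  let ?B = "boundaries p \<Gamma> :: ('a set \<Rightarrow> 'f) set"
  have "trivial_group (cycle_group p \<Gamma> Mod ?B)"
    using assms(1,2) by (simp add: acyclic_over_def reduced_homology_group_def)
  then have "carrier (cycle_group p \<Gamma> Mod ?B) = {?B}"
    by (simp add: trivial_group_def FactGroup_def)
  moreover have "?B #>\<^bsub>cycle_group p \<Gamma>\<^esub> c \<in> carrier (cycle_group p \<Gamma> Mod ?B)"
    using assms(3) by (auto simp: FactGroup_def RCOSETS_def cycle_group_def)
  ultimately have "?B #>\<^bsub>cycle_group p \<Gamma>\<^esub> c = ?B" by blast
  moreover have "(\<lambda>_. 0) \<in> ?B"
    unfolding boundaries_def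
    by (rule image_eqI[of _ _ "\<lambda>_. 0"]) (auto simp: chains_def boundary_incidence)
  then have "c \<in> ?B #>\<^bsub>cycle_group p \<Gamma>\<^esub> c"
    by (auto simp: r_coset_def cycle_group_def intro!: bexI[of _ "\<lambda>_. 0"])
  ultimately show ?thesis by (auto simp: boundaries_def)
qed

text \<open>
  The rows \<open>h \<sigma>\<close> form a chain homotopy between the identity and zero. It is built by recursion on the
  size of \<open>\<sigma>\<close>: with \<open>h\<close> known on smaller faces, \<open>\<sigma> - h (\<partial> \<sigma>)\<close> is a cycle, hence the boundary of a chain,
  which is taken as \<open>h \<sigma>\<close>. Unlike the vanishing of homology, a matrix satisfying an identity can be
  transposed and mapped into a larger field at once.
\<close>

lemma contracting_homotopy:
  assumes fin: "finite \<Gamma>" "\<And>\<sigma>. \<sigma> \<in> \<Gamma> \<Longrightarrow> finite \<sigma>"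
    and down: "\<And>\<sigma> \<tau>. \<sigma> \<in> \<Gamma> \<Longrightarrow> \<tau> \<subseteq> \<sigma> \<Longrightarrow> \<tau> \<in> \<Gamma>"
    and ac: "acyclic_over TYPE('f::field) \<Gamma>"
  shows "\<exists>h :: 'a set \<Rightarrow> 'a set \<Rightarrow> 'f. \<forall>\<sigma>\<in>\<Gamma>. \<forall>\<tau>.
     boundary \<Gamma> (h \<sigma>) \<tau> + wedge (\<lambda>_. 1) (\<lambda>\<rho>. h \<rho> \<tau>) \<sigma> = (if \<sigma> = \<tau> then 1 else 0)"
proof -
  define good where "good h \<sigma> \<longleftrightarrow> h \<sigma> \<in> chains (int (card \<sigma>)) \<Gamma> \<and>
     (\<forall>\<tau>. boundary \<Gamma> (h \<sigma>) \<tau> + wedge (\<lambda>_. 1) (\<lambda>\<rho>. h \<rho> \<tau>) \<sigma> = (if \<sigma> = \<tau> then 1 else 0))"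
    for h :: "'a set \<Rightarrow> 'a set \<Rightarrow> 'f" and \<sigma>
  have "\<exists>h. \<forall>\<sigma>\<in>\<Gamma>. card \<sigma> < n \<longrightarrow> good h \<sigma>" for n
  proof (induction n)
    case (Suc n)
    then obtain h where h: "\<And>\<sigma>. \<sigma> \<in> \<Gamma> \<Longrightarrow> card \<sigma> < n \<Longrightarrow> good h \<sigma>" by blast
    \<comment> \<open>\<open>c \<sigma>\<close> is the cycle \<open>\<sigma> - h (\<partial> \<sigma>)\<close>.\<close>
    define c where "c \<sigma> \<tau> = (if \<sigma> = \<tau> then 1 else 0) - wedge (\<lambda>_. 1) (\<lambda>\<rho>. h \<rho> \<tau>) \<sigma>" for \<sigma> \<tau>
    have ex: "\<exists>d\<in>chains (int n) \<Gamma>. boundary \<Gamma> d = c \<sigma>" if \<sigma>: "\<sigma> \<in> \<Gamma>" "card \<sigma> = n" for \<sigma>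
    proof -
      have \<sigma>v: "\<sigma> - {v} \<in> \<Gamma>" "card (\<sigma> - {v}) < n" "int (card (\<sigma> - {v})) + 1 = int n" if "v \<in> \<sigma>" for v
        using that \<sigma> down[of \<sigma> "\<sigma> - {v}"] fin(2)[OF \<sigma>(1)] card_Suc_Diff1[of \<sigma> v] by auto
      have "c \<sigma> \<in> chains (int n - 1) \<Gamma>"
      proof -
        have "\<tau> \<in> \<Gamma> \<and> card \<tau> = n" if "c \<sigma> \<tau> \<noteq> 0" for \<tau>
        proof (cases "\<sigma> = \<tau>")
          case False
          then have "wedge (\<lambda>_. 1) (\<lambda>\<rho>. h \<rho> \<tau>) \<sigma> \<noteq> 0" using that by (simp add: c_def)
          then obtain v where v: "v \<in> \<sigma>" "h (\<sigma> - {v}) \<tau> \<noteq> 0"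
            unfolding wedge_def by (metis (no_types, lifting) mult_eq_0_iff sum.neutral)
          with h[OF \<sigma>v(1,2)[OF v(1)]] \<sigma>v(3)[OF v(1)] show ?thesis
            by (auto simp: good_def chains_def)
        qed (use \<sigma> in auto)
        then show ?thesis by (auto simp: chains_def)
      qed
      moreover have "boundary \<Gamma> (c \<sigma>) \<rho> = 0" for \<rho>
      proof -
        let ?H = "\<lambda>\<kappa>. h \<kappa> \<rho>"
        have "boundary \<Gamma> (c \<sigma>) \<rho> = incidence \<sigma> \<rho> -
           (\<Sum>\<tau>\<in>\<Gamma>. wedge (\<lambda>_. 1) (\<lambda>\<rho>. h \<rho> \<tau>) \<sigma> * incidence \<tau> \<rho>)"
          using fin(1) \<sigma>(1)
          by (simp add: boundary_incidence c_def left_diff_distrib sum_subtractf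
              if_distrib[of "\<lambda>c. c * _"] sum.delta' cong: if_cong)
        also have "(\<Sum>\<tau>\<in>\<Gamma>. wedge (\<lambda>_. 1) (\<lambda>\<rho>. h \<rho> \<tau>) \<sigma> * incidence \<tau> \<rho>) =
           (\<Sum>v\<in>\<sigma>. orientation_sign v \<sigma> * boundary \<Gamma> (h (\<sigma> - {v})) \<rho>)"
          unfolding wedge_def boundary_incidence sum_distrib_right sum_distrib_left
          by (subst sum.swap) (simp add: algebra_simps)
        also have "\<dots> = (\<Sum>v\<in>\<sigma>. orientation_sign v \<sigma> *
             ((if \<sigma> - {v} = \<rho> then 1 else 0) - wedge (\<lambda>_. 1) ?H (\<sigma> - {v})))"
        proof (rule sum.cong)
          fix v assume "v \<in> \<sigma>"
          from h[OF \<sigma>v(1,2)[OF this]]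
          have "boundary \<Gamma> (h (\<sigma> - {v})) \<rho> + wedge (\<lambda>_. 1) ?H (\<sigma> - {v}) = (if \<sigma> - {v} = \<rho> then 1 else 0)"
            unfolding good_def by blast
          then have "boundary \<Gamma> (h (\<sigma> - {v})) \<rho> = (if \<sigma> - {v} = \<rho> then 1 else 0) - wedge (\<lambda>_. 1) ?H (\<sigma> - {v})"
            by (simp only: eq_diff_eq)
          then show "orientation_sign v \<sigma> * boundary \<Gamma> (h (\<sigma> - {v})) \<rho> = orientation_sign v \<sigma> *
             ((if \<sigma> - {v} = \<rho> then 1 else 0) - wedge (\<lambda>_. 1) ?H (\<sigma> - {v}))"
            by (simp only:)
        qed simp
        also have "\<dots> = incidence \<sigma> \<rho> - wedge (\<lambda>_. 1) (wedge (\<lambda>_. 1) ?H) \<sigma>"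
          unfolding right_diff_distrib sum_subtractf incidence_def
          by (simp add: wedge_def[of _ "wedge _ _"] if_distrib[of "\<lambda>c. _ * c"] eq_commute[of \<rho>] cong: if_cong)
        finally show ?thesis by (simp add: wedge_self)
      qed
      ultimately have "c \<sigma> \<in> cycles (int n - 1) \<Gamma>" by (auto simp: cycles_def)
      from acyclic_cycle_is_boundary[OF ac _ this] show ?thesis by simp
    qed
    then obtain d where d: "\<And>\<sigma>. \<sigma> \<in> \<Gamma> \<Longrightarrow> card \<sigma> = n \<Longrightarrow> d \<sigma> \<in> chains (int n) \<Gamma>"
      "\<And>\<sigma>. \<sigma> \<in> \<Gamma> \<Longrightarrow> card \<sigma> = n \<Longrightarrow> boundary \<Gamma> (d \<sigma>) = c \<sigma>" by metis
    define h' where "h' \<sigma> = (if card \<sigma> < n then h \<sigma> else d \<sigma>)" for \<sigma>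
    have "good h' \<sigma>" if \<sigma>: "\<sigma> \<in> \<Gamma>" "card \<sigma> < Suc n" for \<sigma>
    proof -
      have *: "wedge (\<lambda>_. 1) (\<lambda>\<rho>. h' \<rho> \<tau>) \<sigma> = wedge (\<lambda>_. 1) (\<lambda>\<rho>. h \<rho> \<tau>) \<sigma>" for \<tau>
        unfolding wedge_def
      proof (rule sum.cong)
        fix v assume "v \<in> \<sigma>"
        then have "card (\<sigma> - {v}) < n"
          using \<sigma> fin(2)[OF \<sigma>(1)] card_Suc_Diff1[of \<sigma> v] by auto
        then show "1 * orientation_sign v \<sigma> * h' (\<sigma> - {v}) \<tau> = 1 * orientation_sign v \<sigma> * h (\<sigma> - {v}) \<tau>"
          by (simp add: h'_def)
      qed simp
      show ?thesis
      proof (cases "card \<sigma> < n")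
        case True
        then have e: "h' \<sigma> = h \<sigma>" by (simp add: h'_def)
        from h[OF \<sigma>(1) True] show ?thesis unfolding good_def * e .
      next
        case False
        then have n: "card \<sigma> = n" and e: "h' \<sigma> = d \<sigma>" using \<sigma> by (auto simp: h'_def)
        from d[OF \<sigma>(1) n] n show ?thesis unfolding good_def * e by (simp add: c_def)
      qed
    qed
    then show ?case by blast
  qed simp
  from this[of "Suc (Max (card ` \<Gamma>))"] fin(1) have "\<exists>h. \<forall>\<sigma>\<in>\<Gamma>. good h \<sigma>"
    by (simp add: less_Suc_eq_le)
  then show ?thesis unfolding good_def by blast
qed

text \<open>
  For \<open>q = 1\<close> the transposed homotopy, with entries mapped into the closure, produces a preimage.
  Rescaling \<open>e\<^sub>\<tau>\<close> by \<open>\<Prod>v\<in>\<tau>. q v\<close> reduces nonvanishing weights to this case.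
\<close>

lemma acyclic_imp_wedge_exact:
  fixes q :: "'a \<Rightarrow> 'f::field alg_closure"
  assumes fin: "finite \<Gamma>" "\<And>\<sigma>. \<sigma> \<in> \<Gamma> \<Longrightarrow> finite \<sigma>"
    and down: "\<And>\<sigma> \<tau>. \<sigma> \<in> \<Gamma> \<Longrightarrow> \<tau> \<subseteq> \<sigma> \<Longrightarrow> \<tau> \<in> \<Gamma>"
    and ac: "acyclic_over TYPE('f) \<Gamma>"
    and q: "\<And>v. v \<in> \<Union>\<Gamma> \<Longrightarrow> q v \<noteq> 0"
  shows "wedge_exact \<Gamma> q"
proof -
  obtain h :: "'a set \<Rightarrow> 'a set \<Rightarrow> 'f" where h: "\<And>\<sigma> \<tau>. \<sigma> \<in> \<Gamma> \<Longrightarrow>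
     boundary \<Gamma> (h \<sigma>) \<tau> + wedge (\<lambda>_. 1) (\<lambda>\<rho>. h \<rho> \<tau>) \<sigma> = (if \<sigma> = \<tau> then 1 else 0)"
  proof -
    have "\<exists>h :: 'a set \<Rightarrow> 'a set \<Rightarrow> 'f. \<forall>\<sigma>\<in>\<Gamma>. \<forall>\<tau>.
       boundary \<Gamma> (h \<sigma>) \<tau> + wedge (\<lambda>_. 1) (\<lambda>\<rho>. h \<rho> \<tau>) \<sigma> = (if \<sigma> = \<tau> then 1 else 0)"
      by (rule contracting_homotopy) (use fin down ac in blast)+
    then show ?thesis using that by blast
  qed
  have sgn: "to_ac (orientation_sign v \<sigma>) = orientation_sign v \<sigma>" for v :: 'a and \<sigma>
    by (simp add: orientation_sign_def)
  have inc: "to_ac (incidence \<sigma> \<tau>) = incidence \<sigma> \<tau>" for \<sigma> \<tau> :: "'a set"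
    unfolding incidence_def to_ac_sum by (rule sum.cong) (auto simp: sgn)
  have one: "\<exists>y. \<forall>\<sigma>\<in>\<Gamma>. x \<sigma> = wedge (\<lambda>_. 1) y \<sigma>"
    if x: "\<And>\<sigma>. \<sigma> \<in> \<Gamma> \<Longrightarrow> wedge (\<lambda>_. 1) x \<sigma> = 0" for x :: "'a set \<Rightarrow> 'f alg_closure"
  proof (intro exI ballI)
    fix \<sigma> assume \<sigma>: "\<sigma> \<in> \<Gamma>"
    define y where "y \<rho> = (\<Sum>\<tau>\<in>\<Gamma>. to_ac (h \<rho> \<tau>) * x \<tau>)" for \<rho>
    have "wedge (\<lambda>_. 1) y \<sigma> = (\<Sum>\<tau>\<in>\<Gamma>. to_ac (wedge (\<lambda>_. 1) (\<lambda>\<rho>. h \<rho> \<tau>) \<sigma>) * x \<tau>)"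
      unfolding wedge_def y_def to_ac_sum sum_distrib_left sum_distrib_right
      by (subst sum.swap) (simp add: sgn algebra_simps)
    also have "\<dots> = (\<Sum>\<tau>\<in>\<Gamma>. to_ac ((if \<sigma> = \<tau> then 1 else 0) - boundary \<Gamma> (h \<sigma>) \<tau>) * x \<tau>)"
      by (simp add: h[OF \<sigma>, symmetric])
    also have "\<dots> = x \<sigma> - (\<Sum>\<tau>\<in>\<Gamma>. to_ac (boundary \<Gamma> (h \<sigma>) \<tau>) * x \<tau>)"
      using fin(1) \<sigma>
      by (simp add: left_diff_distrib sum_subtractf if_distrib[of to_ac] if_distrib[of "\<lambda>c. c * _"]
          sum.delta' cong: if_cong)
    also have "(\<Sum>\<tau>\<in>\<Gamma>. to_ac (boundary \<Gamma> (h \<sigma>) \<tau>) * x \<tau>) =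
       (\<Sum>\<kappa>\<in>\<Gamma>. to_ac (h \<sigma> \<kappa>) * (\<Sum>\<tau>\<in>\<Gamma>. incidence \<kappa> \<tau> * x \<tau>))"
      unfolding boundary_incidence to_ac_sum sum_distrib_left sum_distrib_right
      by (subst sum.swap) (simp add: inc algebra_simps)
    also have "\<dots> = (\<Sum>\<kappa>\<in>\<Gamma>. to_ac (h \<sigma> \<kappa>) * wedge (\<lambda>_. 1) x \<kappa>)"
    proof (rule sum.cong)
      fix \<kappa> assume "\<kappa> \<in> \<Gamma>"
      have "wedge (\<lambda>_. 1) x \<kappa> = (\<Sum>\<tau>\<in>\<Gamma>. incidence \<kappa> \<tau> * x \<tau>)"
        by (rule wedge_incidence) (use fin(1) down \<open>\<kappa> \<in> \<Gamma>\<close> in blast)+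
      then show "to_ac (h \<sigma> \<kappa>) * (\<Sum>\<tau>\<in>\<Gamma>. incidence \<kappa> \<tau> * x \<tau>) = to_ac (h \<sigma> \<kappa>) * wedge (\<lambda>_. 1) x \<kappa>"
        by simp
    qed simp
    also have "\<dots> = 0" by (rule sum.neutral) (simp add: x)
    finally show "x \<sigma> = wedge (\<lambda>_. 1) (\<lambda>\<rho>. \<Sum>\<tau>\<in>\<Gamma>. to_ac (h \<rho> \<tau>) * x \<tau>) \<sigma>"
      by (simp add: y_def[abs_def])
  qed
  define Q where "Q \<tau> = prod q \<tau>" for \<tau>
  have Q0: "Q \<tau> \<noteq> 0" if "\<tau> \<in> \<Gamma>" for \<tau>
    using that q fin(2)[OF that] by (auto simp: Q_def prod_zero_iff)
  have scale: "wedge q (\<lambda>\<tau>. Q \<tau> * x \<tau>) \<sigma> = Q \<sigma> * wedge (\<lambda>_. 1) x \<sigma>" if "\<sigma> \<in> \<Gamma>" for x \<sigma>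
  proof -
    have "q v * Q (\<sigma> - {v}) = Q \<sigma>" if "v \<in> \<sigma>" for v
      using that fin(2)[OF \<open>\<sigma> \<in> \<Gamma>\<close>] by (simp add: Q_def prod.remove)
    note m = this
    show ?thesis unfolding wedge_def sum_distrib_left
    proof (rule sum.cong)
      fix v assume "v \<in> \<sigma>"
      show "q v * orientation_sign v \<sigma> * (Q (\<sigma> - {v}) * x (\<sigma> - {v}))
          = Q \<sigma> * (1 * orientation_sign v \<sigma> * x (\<sigma> - {v}))"
        unfolding m[OF \<open>v \<in> \<sigma>\<close>, symmetric] by (simp only: mult_ac mult_1_left)
    qed simp
  qed
  show ?thesis
    unfolding wedge_exact_def
  proof (intro allI impI)
    fix x assume x: "\<forall>\<tau>\<in>\<Gamma>. wedge q x \<tau> = 0"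
    have "wedge (\<lambda>_. 1) (\<lambda>\<tau>. x \<tau> / Q \<tau>) \<sigma> = 0" if \<sigma>: "\<sigma> \<in> \<Gamma>" for \<sigma>
    proof -
      have "wedge q (\<lambda>\<tau>. Q \<tau> * (x \<tau> / Q \<tau>)) \<sigma> = wedge q x \<sigma>"
        unfolding wedge_def
      proof (rule sum.cong)
        fix v assume "v \<in> \<sigma>"
        have "\<sigma> - {v} \<in> \<Gamma>" using \<sigma> down by blast
        from Q0[OF this] show "q v * orientation_sign v \<sigma> * (Q (\<sigma> - {v}) * (x (\<sigma> - {v}) / Q (\<sigma> - {v})))
          = q v * orientation_sign v \<sigma> * x (\<sigma> - {v})" by simp
      qed simp
      with scale[OF \<sigma>, of "\<lambda>\<tau>. x \<tau> / Q \<tau>"] x \<sigma> Q0[OF \<sigma>] show ?thesis by simp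
    qed
    from one[OF this] obtain y where y: "\<And>\<sigma>. \<sigma> \<in> \<Gamma> \<Longrightarrow> x \<sigma> / Q \<sigma> = wedge (\<lambda>_. 1) y \<sigma>" by blast
    show "\<exists>y. \<forall>\<tau>\<in>\<Gamma>. x \<tau> = wedge q y \<tau>"
    proof (intro exI ballI)
      fix \<tau> assume \<tau>: "\<tau> \<in> \<Gamma>"
      have "x \<tau> = Q \<tau> * wedge (\<lambda>_. 1) y \<tau>" using y[OF \<tau>] Q0[OF \<tau>] by (simp add: field_simps)
      then show "x \<tau> = wedge q (\<lambda>\<tau>. Q \<tau> * y \<tau>) \<tau>" by (simp only: scale[OF \<tau>])
    qed
  qed
qed


section \<open>Exactness for weights with few zeros\<close>

lemma link_insert:
  assumes "\<sigma> \<in> link \<Delta> {w}" "\<And>\<sigma> \<tau>. \<sigma> \<in> \<Delta> \<Longrightarrow> \<tau> \<subseteq> \<sigma> \<Longrightarrow> \<tau> \<in> \<Delta>"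
  shows "link (link \<Delta> {w}) \<sigma> = link \<Delta> (insert w \<sigma>)"
proof -
  have *: "insert w (\<tau> \<union> \<sigma>) \<in> \<Delta> \<Longrightarrow> \<rho> \<subseteq> insert w (\<tau> \<union> \<sigma>) \<Longrightarrow> \<rho> \<in> \<Delta>" for \<tau> \<rho>
    by (rule assms(2))
  show ?thesis
    using assms(1) by (auto simp: link_def intro: *)
qed

text \<open>
  By induction on the set \<open>W\<close> of zeros of \<open>q\<close>. For a zero \<open>w\<close>, the induction hypothesis applies to
  the link of \<open>w\<close>, with \<open>k - 1\<close> and the zeros other than \<open>w\<close>, and to \<open>\<Delta>\<close> itself with \<open>q w\<close> changed to \<open>1\<close>.
  Since \<open>q w = 0\<close>, a cocycle splits into a part \<open>x0\<close> on the faces without \<open>w\<close> and a part \<open>e\<^sub>w x1\<close> with \<open>x1\<close>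
  on the link, and both parts are cocycles. Exactness on the link disposes of \<open>x1\<close>. It also corrects \<open>x0\<close> by some
  \<open>e\<^sub>w y\<close> to a cocycle for the changed weights, whose preimage, restricted to the faces without \<open>w\<close>, is one of \<open>x0\<close>.
\<close>

lemma k_fold_wedge_exact:
  fixes q :: "'a \<Rightarrow> 'k::field"
  assumes "finite W"
    and "\<And>\<sigma> \<tau>. \<sigma> \<in> \<Delta> \<Longrightarrow> \<tau> \<subseteq> \<sigma> \<Longrightarrow> \<tau> \<in> \<Delta>" and "\<And>\<sigma>. \<sigma> \<in> \<Delta> \<Longrightarrow> finite \<sigma>"
    and "{} \<in> \<Delta>"
    and "\<And>\<sigma> q :: 'a \<Rightarrow> 'k. \<sigma> \<in> \<Delta> \<Longrightarrow> card \<sigma> < k \<Longrightarrow> (\<And>v. v \<in> \<Union>(link \<Delta> \<sigma>) \<Longrightarrow> q v \<noteq> 0) \<Longrightarrow>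
            wedge_exact (link \<Delta> \<sigma>) q"
    and "card W < k" and "\<And>v. v \<in> \<Union>\<Delta> \<Longrightarrow> q v = 0 \<Longrightarrow> v \<in> W"
  shows "wedge_exact \<Delta> q"
  using assms
proof (induction W arbitrary: \<Delta> k q rule: finite_induct)
  case (empty \<Delta> k q)
  have "link \<Delta> {} = \<Delta>" by (auto simp: link_def)
  with empty.prems(4)[of "{}" q] empty.prems show ?case by force
next
  case (insert w W \<Delta> k q)
  note down = insert.prems(1) and fin = insert.prems(2) and lnk = insert.prems(4)
  define q' where "q' = q(w := 1)"
  have "wedge_exact \<Delta> q'"
  proof (rule insert.IH[of \<Delta> k, OF down fin insert.prems(3) lnk])
    show "card W < k" using insert.prems(5) insert.hyps by simp
    show "v \<in> W" if "v \<in> \<Union>\<Delta>" "q' v = 0" for v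
      using that insert.prems(6)[of v] by (auto simp: q'_def split: if_splits)
  qed
  show ?case
  proof (cases "{w} \<in> \<Delta> \<and> q w = 0")
    case False
    have "v \<in> W" if "v \<in> \<Union>\<Delta>" "q v = 0" for v
    proof -
      from that(1) obtain \<sigma> where "\<sigma> \<in> \<Delta>" "v \<in> \<sigma>" by blast
      with down[of \<sigma> "{v}"] have "{v} \<in> \<Delta>" by auto
      with insert.prems(6)[OF that] False that(2) show ?thesis by auto
    qed
    with insert.prems(5) insert.hyps show ?thesis
      by (intro insert.IH[of \<Delta> k, OF down fin insert.prems(3) lnk]) simp_all
  next
    case True
    then have w: "{w} \<in> \<Delta>" and qw: "q w = 0" by auto
    define L where "L = link \<Delta> {w}"
    have L: "\<tau> \<in> L \<longleftrightarrow> insert w \<tau> \<in> \<Delta> \<and> w \<notin> \<tau>" for \<tau>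
      using down[of "insert w \<tau>" \<tau>] by (auto simp: L_def link_def)
    have LD: "L \<subseteq> \<Delta>" by (auto simp: L_def link_def)
    have "wedge_exact L q"
    proof (rule insert.IH[of L "k - 1"])
      show "\<tau> \<in> L" if "\<sigma> \<in> L" "\<tau> \<subseteq> \<sigma>" for \<sigma> \<tau>
        using that down[of "insert w \<sigma>" "insert w \<tau>"] by (auto simp: L)
      show "finite \<sigma>" if "\<sigma> \<in> L" for \<sigma> using that LD fin by blast
      show "{} \<in> L" using w by (simp add: L)
      show "card W < k - 1" using insert.prems(5) insert.hyps by auto
      show "v \<in> W" if "v \<in> \<Union>L" "q v = 0" for v
      proof -
        from that(1) obtain \<sigma> where "\<sigma> \<in> L" "v \<in> \<sigma>" by blast
        then have "v \<in> \<Union>\<Delta>" "v \<noteq> w" using LD by (auto simp: L)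
        with insert.prems(6)[OF _ that(2)] show ?thesis by blast
      qed
      fix \<sigma> and p :: "'a \<Rightarrow> 'k"
      assume \<sigma>: "\<sigma> \<in> L" "card \<sigma> < k - 1" and p: "\<And>v. v \<in> \<Union>(link L \<sigma>) \<Longrightarrow> p v \<noteq> 0"
      have *: "link L \<sigma> = link \<Delta> (insert w \<sigma>)"
        unfolding L_def by (rule link_insert) (use \<sigma> down in \<open>auto simp: L_def\<close>)
      show "wedge_exact (link L \<sigma>) p"
        unfolding * by (rule lnk) (use \<sigma> fin[of \<sigma>] LD p in \<open>auto simp: L *\<close>)
    qed
    define E where "E = wedge (\<lambda>v. if v = w then 1 else (0::'k))"
    have E: "E x \<tau> = (if finite \<tau> \<and> w \<in> \<tau> then orientation_sign w \<tau> * x (\<tau> - {w}) else 0)" for x \<tau>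
      by (cases "finite \<tau>") (auto simp: E_def wedge_def if_distrib[of "\<lambda>c. c * _"] cong: if_cong)
    have q': "wedge q' x = wedge q x + E x" for x
    proof -
      have "q' = (\<lambda>v. q v + (if v = w then 1 else 0))" using qw by (auto simp: q'_def)
      then show ?thesis by (simp add: wedge_add_weights E_def)
    qed
    have Eadd: "E (x + y) = E x + E y" for x y by (simp only: E_def wedge_add)
    have EE: "E (E x) = 0" for x by (simp add: E_def wedge_self)
    have Eq: "wedge q (E x) = - E (wedge q x)" for x by (simp add: E_def wedge_anticommute[of q])
    have free: "wedge q x \<tau> = wedge q (\<lambda>\<tau>. if w \<in> \<tau> then 0 else x \<tau>) \<tau>" if "w \<notin> \<tau>" for x \<tau>
      unfolding wedge_def using that by (intro sum.cong) auto
    have full: "wedge q (\<lambda>\<tau>. if w \<in> \<tau> then 0 else x \<tau>) \<tau> = 0" if "w \<in> \<tau>" for x \<tau>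
      unfolding wedge_def using that qw by (intro sum.neutral) auto
    show ?thesis
      unfolding wedge_exact_def
    proof (intro allI impI)
      fix x assume x: "\<forall>\<tau>\<in>\<Delta>. wedge q x \<tau> = 0"
      define x0 where "x0 = (\<lambda>\<tau>. if w \<in> \<tau> then 0 else x \<tau>)"
      define x1 where "x1 \<tau> = orientation_sign w (insert w \<tau>) * x (insert w \<tau>)" for \<tau>
      have sq: "orientation_sign w \<tau> * orientation_sign w \<tau> = (1::'k)" for \<tau>
        by (simp add: orientation_sign_def flip: power_add mult_2)
      have dec: "x \<tau> = x0 \<tau> + E x1 \<tau>" if "finite \<tau>" for \<tau>
        using that by (auto simp: x0_def x1_def E insert_absorb sq simp flip: mult.assoc)
      have x0: "wedge q x0 \<tau> = 0" if "\<tau> \<in> \<Delta>" for \<tau>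
        using x that free[of \<tau> x] full[of \<tau> x] by (cases "w \<in> \<tau>") (auto simp: x0_def)
      have dec': "wedge q x \<tau> = wedge q x0 \<tau> + wedge q (E x1) \<tau>" if "finite \<tau>" for \<tau>
      proof -
        have "wedge q x \<tau> = wedge q (x0 + E x1) \<tau>"
          unfolding wedge_def using dec that by (intro sum.cong) auto
        then show ?thesis by (simp add: wedge_add)
      qed
      have "wedge q x1 \<tau> = 0" if \<tau>: "\<tau> \<in> L" for \<tau>
      proof -
        have i: "insert w \<tau> \<in> \<Delta>" "w \<notin> \<tau>" "finite \<tau>" using \<tau> fin LD by (auto simp: L)
        have "wedge q (E x1) (insert w \<tau>) = 0" using dec'[of "insert w \<tau>"] x x0 i by simp
        then show ?thesis using i by (simp add: Eq E)
      qed
      with \<open>wedge_exact L q\<close> obtain y1 where y1: "\<And>\<tau>. \<tau> \<in> L \<Longrightarrow> x1 \<tau> = wedge q y1 \<tau>"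
        unfolding wedge_exact_def by blast
      have Ex1: "E x1 \<tau> = - wedge q (E y1) \<tau>" if "\<tau> \<in> \<Delta>" for \<tau>
      proof (cases "w \<in> \<tau>")
        case True
        then have "\<tau> - {w} \<in> L" using that by (simp add: L insert_absorb)
        from y1[OF this] show ?thesis by (simp add: Eq E)
      qed (simp add: Eq E)
      from x0 LD \<open>wedge_exact L q\<close> obtain y where y: "\<And>\<tau>. \<tau> \<in> L \<Longrightarrow> x0 \<tau> = wedge q y \<tau>"
        unfolding wedge_exact_def by (meson subsetD)
      have "wedge q' (x0 + E y) \<tau> = 0" if \<tau>: "\<tau> \<in> \<Delta>" for \<tau>
      proof -
        have "wedge q' (x0 + E y) \<tau> = wedge q x0 \<tau> + (E x0 \<tau> - E (wedge q y) \<tau>)"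
          by (simp add: q' wedge_add Eq EE Eadd)
        moreover have "E x0 \<tau> = E (wedge q y) \<tau>"
        proof (cases "w \<in> \<tau>")
          case True
          then have "\<tau> - {w} \<in> L" using that by (simp add: L insert_absorb)
          from y[OF this] show ?thesis by (simp add: E)
        qed (simp add: E)
        ultimately show ?thesis using x0[OF \<tau>] by (simp only: diff_self add_0_right)
      qed
      with \<open>wedge_exact \<Delta> q'\<close> obtain z where z: "\<And>\<tau>. \<tau> \<in> \<Delta> \<Longrightarrow> (x0 + E y) \<tau> = wedge q' z \<tau>"
        unfolding wedge_exact_def by blast
      define z0 where "z0 = (\<lambda>\<tau>. if w \<in> \<tau> then 0 else z \<tau>)"
      have z0: "x0 \<tau> = wedge q z0 \<tau>" if "\<tau> \<in> \<Delta>" for \<tau>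
      proof (cases "w \<in> \<tau>")
        case True
        then show ?thesis using full[of \<tau> z] by (simp add: x0_def z0_def)
      next
        case False
        then show ?thesis using z[OF that] free[of \<tau> z] by (simp add: q' E z0_def)
      qed
      show "\<exists>y. \<forall>\<tau>\<in>\<Delta>. x \<tau> = wedge q y \<tau>"
        by (intro exI[of _ "z0 - E y1"] ballI) (simp add: dec[OF fin] z0 Ex1 wedge_diff)
    qed
  qed
qed

section \<open>Growing boolean trees\<close>

lemma minimal_elements_eqI:
  fixes T :: "'b::order set"
  assumes "r \<in> T" "\<And>x. x \<in> T \<Longrightarrow> r \<le> x"
  shows "minimal_elements T = {r}"
  unfolding minimal_elements_def using assms by (auto simp: less_le_not_le dest: order.antisym)

lemma boolean_tree_root:
  assumes "boolean_tree P i T" "minimal_elements T = {r}"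
  shows "r \<in> T" "\<And>x. x \<in> T \<Longrightarrow> r \<le> x"
  using boolean_tree_unique_minimal[OF assms(1)] assms(2) by (auto simp: minimal_elements_def)

lemma minimal_elements_join:
  assumes "boolean_tree P i T1" "boolean_tree P i T2"
    and "minimal_elements T1 = {r1}" "minimal_elements T2 = {r2}" "covers P r2 r1"
  shows "minimal_elements (T1 \<union> T2) = {r1}"
proof (rule minimal_elements_eqI)
  show "r1 \<in> T1 \<union> T2" using boolean_tree_root[OF assms(1,3)] by blast
  fix x assume "x \<in> T1 \<union> T2"
  moreover have "r1 \<le> r2" using assms(5) by (auto simp: covers_def)
  ultimately show "r1 \<le> x"
    using boolean_tree_root(2)[OF assms(1,3)] boolean_tree_root(2)[OF assms(2,4)]
    by (auto intro: order.trans)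
qed

text \<open>
  A boolean tree of rank \<open>i + 1\<close> arises not only by joining two trees of rank \<open>i\<close> at their roots, but
  also from one tree of rank \<open>i\<close> by attaching a new leaf to each of its nodes. In the induction, growing
  commutes with joining because it keeps the roots.
\<close>

lemma boolean_tree_grow:
  assumes "boolean_tree P i T" and "T \<subseteq> S" "inj_on f S" "f ` S \<inter> S = {}"
    and "\<And>x. x \<in> S \<Longrightarrow> covers P (f x) x"
  shows "boolean_tree P (Suc i) (T \<union> f ` T) \<and> minimal_elements (T \<union> f ` T) = minimal_elements T"
  using assms(1,2)
proof induction
  case (single x)
  then have c: "covers P (f x) x" using assms(5) by auto
  have "boolean_tree P (Suc 0) ({x} \<union> {f x})"
    by (rule boolean_tree.join) (use c in \<open>auto intro: boolean_tree.single simp: covers_def minimal_elements_def\<close>)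
  moreover have "minimal_elements ({x} \<union> {f x}) = {x}"
    by (rule minimal_elements_eqI) (use c in \<open>auto simp: covers_def\<close>)
  moreover have "minimal_elements {x} = {x}" by (rule minimal_elements_eqI) auto
  ultimately show ?case by simp
next
  case (join i T1 T2 r1 r2)
  have min: "minimal_elements (T1 \<union> T2) = {r1}"
    by (rule minimal_elements_join[OF join.hyps(1,2,4-6)])
  have e: "T1 \<union> T2 \<union> f ` (T1 \<union> T2) = (T1 \<union> f ` T1) \<union> (T2 \<union> f ` T2)" by auto
  have IH: "boolean_tree P (Suc i) (T1 \<union> f ` T1)" "minimal_elements (T1 \<union> f ` T1) = {r1}"
    "boolean_tree P (Suc i) (T2 \<union> f ` T2)" "minimal_elements (T2 \<union> f ` T2) = {r2}"
    using join by auto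
  have d: "(T1 \<union> f ` T1) \<inter> (T2 \<union> f ` T2) = {}"
  proof -
    have "f ` T1 \<inter> f ` T2 = {}"
      using inj_on_image_Int[OF assms(3), of T1 T2] join by simp
    moreover have "f ` T1 \<inter> T2 = {}" "T1 \<inter> f ` T2 = {}" using assms(4) join.prems by blast+
    ultimately show ?thesis using join.hyps(3) by blast
  qed
  have t: "boolean_tree P (Suc (Suc i)) ((T1 \<union> f ` T1) \<union> (T2 \<union> f ` T2))"
    by (rule boolean_tree.join[OF IH(1,3) d IH(2,4) join.hyps(6)])
  have "minimal_elements ((T1 \<union> f ` T1) \<union> (T2 \<union> f ` T2)) = {r1}"
    by (rule minimal_elements_join[OF IH(1,3,2,4) join.hyps(6)])
  with t min show ?case by (simp add: e)
qed

lemma boolean_tree_partition_grow: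
  assumes part: "partition_on S \<T>" and trees: "\<And>T. T \<in> \<T> \<Longrightarrow> boolean_tree P i T"
    and f: "inj_on f S" "f ` S \<inter> S = {}" and c: "\<And>x. x \<in> S \<Longrightarrow> covers P (f x) x"
  shows "\<exists>\<U>. partition_on (S \<union> f ` S) \<U> \<and> (\<forall>T\<in>\<U>. boolean_tree P (Suc i) T) \<and>
     (\<Union>T\<in>\<U>. minimal_elements T) = (\<Union>T\<in>\<T>. minimal_elements T)"
proof -
  have S: "\<Union>\<T> = S" and ne: "{} \<notin> \<T>" and dis: "\<And>A B. A \<in> \<T> \<Longrightarrow> B \<in> \<T> \<Longrightarrow> A \<noteq> B \<Longrightarrow> A \<inter> B = {}"
    using part by (auto simp: partition_on_def disjoint_def)
  define g where "g T = T \<union> f ` T" for T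
  have grow: "boolean_tree P (Suc i) (g T) \<and> minimal_elements (g T) = minimal_elements T" if "T \<in> \<T>" for T
    unfolding g_def by (rule boolean_tree_grow[OF trees[OF that] _ f c]) (use S that in auto)
  have "disjnt (g A) (g B)" if "A \<in> \<T>" "B \<in> \<T>" "A \<noteq> B" for A B
  proof -
    have "A \<subseteq> S" "B \<subseteq> S" using S that by auto
    then have "f ` A \<inter> B = {}" "A \<inter> f ` B = {}" using f(2) by blast+
    moreover have "f ` A \<inter> f ` B = {}"
      using inj_on_image_Int[OF f(1) \<open>A \<subseteq> S\<close> \<open>B \<subseteq> S\<close>] dis[OF that] by simp
    ultimately show ?thesis using dis[OF that] unfolding g_def disjnt_def by blast
  qed
  then have "disjoint (g ` \<T>)"
    by (auto simp: pairwise_def disjnt_def)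
  then have "partition_on (S \<union> f ` S) (g ` \<T>)"
    using S ne by (auto simp: partition_on_def g_def)
  then show ?thesis
    by (rule_tac exI[of _ "g ` \<T>"]) (use grow in auto)
qed


section \<open>Bases of faces\<close>

lemma infinite_alg_closed: "infinite (UNIV :: 'k::alg_closed_field set)"
proof
  assume fin: "finite (UNIV :: 'k set)"
  define p :: "'k poly" where "p = (\<Prod>a\<in>UNIV. [:- a, 1:]) + 1"
  have "degree (\<Prod>a\<in>(UNIV::'k set). [:- a, 1:]) = card (UNIV :: 'k set)"
    by (subst degree_prod_sum_eq) auto
  then have "degree p = card (UNIV :: 'k set)"
    unfolding p_def using fin by (subst degree_add_eq_left) (auto simp: card_gt_0_iff)
  then have "degree p > 0" using fin by (simp add: card_gt_0_iff)
  then obtain x where "poly p x = 0" using alg_closed_imp_poly_has_root by blast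
  moreover have "poly p x = 1" using fin by (simp add: p_def poly_prod prod_zero_iff)
  ultimately show False by simp
qed

definition face_vector :: "'a set \<Rightarrow> 'a set \<Rightarrow> 'k::field" where
  "face_vector \<sigma> = (\<lambda>\<tau>. if \<tau> = \<sigma> then 1 else 0)"

lemma sum_face_vector:
  assumes "finite S"
  shows "(\<Sum>\<sigma>\<in>S. scale_fun (a \<sigma>) (face_vector \<sigma>)) \<tau> = (if \<tau> \<in> S then a \<tau> else 0)"
proof -
  have "(\<Sum>\<sigma>\<in>S. scale_fun (a \<sigma>) (face_vector \<sigma>)) \<tau> = (\<Sum>\<sigma>\<in>S. scale_fun (a \<sigma>) (face_vector \<sigma>) \<tau>)"
    using assms by (induction S rule: finite_induct) auto
  also have "\<dots> = (\<Sum>\<sigma>\<in>S. if \<sigma> = \<tau> then a \<sigma> else 0)"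
    by (rule sum.cong) (auto simp: scale_fun_def face_vector_def)
  finally show ?thesis using assms by (simp add: sum.delta)
qed

lemma subspace_vanishing: "cochain.subspace (vanishing \<Delta>)"
  by (rule cochain.subspaceI) (auto simp: vanishing_def scale_fun_def)

lemma span_face_vectors:
  assumes "finite \<Delta>"
  shows "cochain.span (face_vector ` \<Delta> \<union> vanishing \<Delta>) = UNIV"
proof -
  have "x \<in> cochain.span (face_vector ` \<Delta> \<union> vanishing \<Delta>)" for x
  proof -
    let ?s = "\<Sum>\<sigma>\<in>\<Delta>. scale_fun (x \<sigma>) (face_vector \<sigma>)"
    have "?s \<in> cochain.span (face_vector ` \<Delta> \<union> vanishing \<Delta>)"
      by (intro cochain.span_sum cochain.span_scale cochain.span_base) auto
    moreover have "x - ?s \<in> cochain.span (face_vector ` \<Delta> \<union> vanishing \<Delta>)"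
      by (rule cochain.span_base) (auto simp: vanishing_def sum_face_vector[OF assms])
    ultimately have "?s + (x - ?s) \<in> cochain.span (face_vector ` \<Delta> \<union> vanishing \<Delta>)" by (rule cochain.span_add)
    then show ?thesis by simp
  qed
  then show ?thesis by auto
qed

text \<open>
  The ideals \<open>J\<close> of the exterior algebra that contain the ideal of nonfaces; \<open>V / J\<close> is then a quotient of
  the exterior face ring of \<open>\<Delta>\<close>.
\<close>

locale face_ideal =
  fixes \<Delta> :: "'a set set" and J :: "('a set \<Rightarrow> 'k::field) set"
  assumes finite_faces: "finite \<Delta>" and finite_face: "\<And>\<sigma>. \<sigma> \<in> \<Delta> \<Longrightarrow> finite \<sigma>"
    and down: "\<And>\<sigma> \<tau>. \<sigma> \<in> \<Delta> \<Longrightarrow> \<tau> \<subseteq> \<sigma> \<Longrightarrow> \<tau> \<in> \<Delta>"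
    and subspace: "cochain.subspace J"
    and vanishing_sub: "vanishing \<Delta> \<subseteq> J"
    and wedge_closed: "\<And>q x. x \<in> J \<Longrightarrow> wedge q x \<in> J"
begin

lemma face_ideal_add_image: "face_ideal \<Delta> (cochain.add_image J (wedge q))"
proof
  show "cochain.subspace (cochain.add_image J (wedge q))"
    by (rule cochain.subspace_add_image[OF subspace linear_wedge])
  show "vanishing \<Delta> \<subseteq> cochain.add_image J (wedge q)"
    using vanishing_sub cochain.add_image_superset[OF linear_wedge] by blast
  fix p x assume "x \<in> cochain.add_image J (wedge q)"
  then obtain y where "x - wedge q y \<in> J" by (auto simp: cochain.add_image_def)
  from wedge_closed[OF this, of p] have "wedge p x - wedge q (- wedge p y) \<in> J"
    using wedge_diff[of q 0 "wedge p y"] by (simp add: wedge_diff wedge_zero wedge_anticommute[of p q])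
  then show "wedge p x \<in> cochain.add_image J (wedge q)" by (auto simp: cochain.add_image_def)
qed (use finite_faces finite_face down in auto)

text \<open>
  A Groebner basis argument. Comparing faces as binary numbers gives a total order that is compatible
  with adding a vertex. A face is standard if it is not the leading, that is largest, face of an element of \<open>J\<close>.
  Standard faces are independent modulo \<open>J\<close> since a relation would have a leading face, they span because a
  nonstandard face reduces to smaller ones, and subsets of standard faces are standard because multiplying
  an element of \<open>J\<close> by \<open>e\<^sub>v\<close> adds \<open>v\<close> to its leading face.
\<close>

lemma standard_faces:
  "\<exists>S \<subseteq> \<Delta>. (\<forall>\<sigma>\<in>S. \<forall>\<tau>. \<tau> \<subseteq> \<sigma> \<longrightarrow> \<tau> \<in> S) \<and> cochain.basis_mod J S face_vector"
proof -
  have "finite (\<Union>\<Delta>)" using finite_faces finite_face by auto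
  then obtain idx :: "'a \<Rightarrow> nat" where idx: "inj_on idx (\<Union>\<Delta>)" using finite_imp_inj_to_nat_seg by blast
  define key where "key \<sigma> = set_encode (idx ` \<sigma>)" for \<sigma>
  have key_inj: "\<sigma> = \<tau>" if "key \<sigma> = key \<tau>" "\<sigma> \<in> \<Delta>" "\<tau> \<in> \<Delta>" for \<sigma> \<tau>
  proof -
    have "idx ` \<sigma> = idx ` \<tau>"
      using that finite_face by (simp add: key_def set_encode_eq)
    then show ?thesis using inj_on_image_eq_iff[OF idx, of \<sigma> \<tau>] that by blast
  qed
  have key_insert: "key (insert v \<sigma>) = key \<sigma> + 2 ^ idx v" if "insert v \<sigma> \<in> \<Delta>" "v \<notin> \<sigma>" for v \<sigma>
  proof -
    have "v \<in> \<Union>\<Delta>" "\<sigma> \<subseteq> \<Union>\<Delta>" using that(1) by blast+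
    from inj_on_image_mem_iff[OF idx this] that(2) have "idx v \<notin> idx ` \<sigma>" by simp
    then show ?thesis using finite_face[OF that(1)] by (simp add: key_def)
  qed
  define lead where "lead \<sigma> x \<longleftrightarrow> x \<in> J \<and> x \<sigma> \<noteq> 0 \<and> (\<forall>\<tau>\<in>\<Delta>. key \<sigma> < key \<tau> \<longrightarrow> x \<tau> = 0)" for \<sigma> x
  define S where "S = {\<sigma> \<in> \<Delta>. \<nexists>x. lead \<sigma> x}"
  have S: "S \<subseteq> \<Delta>" "finite S" using finite_faces by (auto simp: S_def)
  have "cochain.basis_mod J S face_vector" unfolding cochain.basis_mod_def
  proof (intro conjI allI impI ballI)
    fix a :: "'a set \<Rightarrow> 'k" and \<sigma>
    assume a: "(\<Sum>i\<in>S. scale_fun (a i) (face_vector i)) \<in> J" and \<sigma>: "\<sigma> \<in> S"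
    show "a \<sigma> = 0"
    proof (rule ccontr)
      assume "a \<sigma> \<noteq> 0"
      define N where "N = {\<tau> \<in> S. a \<tau> \<noteq> 0}"
      have N: "finite (key ` N)" "key ` N \<noteq> {}" using S \<sigma> \<open>a \<sigma> \<noteq> 0\<close> by (auto simp: N_def)
      from Max_in[OF N] obtain \<rho> where \<rho>: "\<rho> \<in> N" "key \<rho> = Max (key ` N)" by (metis imageE)
      define x where "x = (\<Sum>i\<in>S. scale_fun (a i) (face_vector i))"
      have x: "x \<in> J" "\<And>\<tau>. x \<tau> = (if \<tau> \<in> S then a \<tau> else 0)"
        using a by (simp_all add: x_def sum_face_vector[OF S(2)])
      have "lead \<rho> x"
        unfolding lead_def
      proof (intro conjI x(1) ballI impI)
        fix \<tau> assume "key \<rho> < key \<tau>"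
        then have "\<tau> \<notin> N" using \<rho>(2) Max_ge[OF N(1)] by (metis imageI leD)
        then show "x \<tau> = 0" by (auto simp: N_def x(2))
      next
        show "x \<rho> \<noteq> 0" using \<rho>(1) by (simp add: N_def x(2))
      qed
      with \<rho>(1) show False by (auto simp: N_def S_def)
    qed
  next
    define R where "R = cochain.span (face_vector ` S \<union> J)"
    have R: "cochain.subspace R" by (simp add: R_def)
    have J: "J \<subseteq> R" by (auto simp: R_def intro: cochain.span_base)
    have face: "face_vector \<sigma> \<in> R" if "\<sigma> \<in> \<Delta>" for \<sigma>
      using that
    proof (induction "key \<sigma>" arbitrary: \<sigma> rule: less_induct)
      case less
      show ?case
      proof (cases "\<sigma> \<in> S")
        case True
        then show ?thesis by (auto simp: R_def intro: cochain.span_base)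
      next
        case False
        with less.prems obtain x where x: "x \<in> J" "x \<sigma> \<noteq> 0" "\<And>\<tau>. \<tau> \<in> \<Delta> \<Longrightarrow> key \<sigma> < key \<tau> \<Longrightarrow> x \<tau> = 0"
          by (auto simp: S_def lead_def)
        define \<Lambda> where "\<Lambda> = {\<tau> \<in> \<Delta>. key \<tau> < key \<sigma>}"
        have fL: "finite \<Lambda>" using finite_faces by (simp add: \<Lambda>_def)
        let ?r = "\<Sum>\<tau>\<in>\<Lambda>. scale_fun (x \<tau>) (face_vector \<tau>)"
        have r: "?r \<in> R"
          by (intro cochain.subspace_sum[OF R] cochain.subspace_scale[OF R] less.hyps) (auto simp: \<Lambda>_def)
        have "x - (scale_fun (x \<sigma>) (face_vector \<sigma>) + ?r) \<in> vanishing \<Delta>"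
        proof -
          have "x \<tau> = x \<sigma> * face_vector \<sigma> \<tau> + (if \<tau> \<in> \<Lambda> then x \<tau> else 0)" if "\<tau> \<in> \<Delta>" for \<tau>
            using x(3)[OF that] key_inj[OF _ that less.prems] that
            by (cases "key \<tau>" "key \<sigma>" rule: linorder_cases) (auto simp: face_vector_def \<Lambda>_def)
          then show ?thesis by (simp add: vanishing_def sum_face_vector[OF fL] scale_fun_apply)
        qed
        then have "x - (scale_fun (x \<sigma>) (face_vector \<sigma>) + ?r) \<in> R" using vanishing_sub J by blast
        from cochain.subspace_diff[OF R cochain.subspace_diff[OF R _ this] r, of x] x(1) J
        have "scale_fun (x \<sigma>) (face_vector \<sigma>) \<in> R" by auto
        from cochain.subspace_scale[OF R this, of "inverse (x \<sigma>)"] x(2) show ?thesis by simp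
      qed
    qed
    fix x
    have "cochain.span (face_vector ` \<Delta> \<union> vanishing \<Delta>) \<subseteq> R"
      by (rule cochain.span_minimal) (use face J vanishing_sub R in auto)
    then have "x \<in> R" using span_face_vectors[OF finite_faces] by blast
    then show "\<exists>a. x - (\<Sum>i\<in>S. scale_fun (a i) (face_vector i)) \<in> J"
      by (simp add: R_def cochain.span_image_Un_subspace_iff[OF subspace S(2)])
  qed (rule S(2))
  moreover have "\<tau> \<in> S" if "\<sigma> \<in> S" "\<tau> \<subseteq> \<sigma>" for \<sigma> \<tau>
  proof -
    have step: "\<rho> \<in> S" if "insert v \<rho> \<in> S" "v \<notin> \<rho>" for v \<rho>
    proof (rule ccontr)
      assume "\<rho> \<notin> S"
      have i: "insert v \<rho> \<in> \<Delta>" "finite \<rho>" using that S finite_face[of "insert v \<rho>"] by auto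
      then have "\<rho> \<in> \<Delta>" using down by blast
      with \<open>\<rho> \<notin> S\<close> obtain x where x: "lead \<rho> x" by (auto simp: S_def)
      define E where "E = wedge (\<lambda>u. if u = v then 1 else (0::'k)) x"
      have E: "E \<tau> = (if v \<in> \<tau> then orientation_sign v \<tau> * x (\<tau> - {v}) else 0)" if "\<tau> \<in> \<Delta>" for \<tau>
        using finite_face[OF that]
        by (auto simp: E_def wedge_def if_distrib[of "\<lambda>c. c * _"] cong: if_cong)
      have "lead (insert v \<rho>) E" unfolding lead_def
      proof (intro conjI ballI impI)
        show "E \<in> J" using x by (auto simp: E_def lead_def intro: wedge_closed)
        show "E (insert v \<rho>) \<noteq> 0" using x that(2) by (simp add: E[OF i(1)] lead_def)
        fix \<tau> assume \<tau>: "\<tau> \<in> \<Delta>" "key (insert v \<rho>) < key \<tau>"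
        show "E \<tau> = 0"
        proof (cases "v \<in> \<tau>")
          case True
          then have it: "insert v (\<tau> - {v}) = \<tau>" by auto
          have "key \<tau> = key (\<tau> - {v}) + 2 ^ idx v" using key_insert[of v "\<tau> - {v}"] \<tau>(1) it by auto
          with \<tau>(2) key_insert[OF i(1) that(2)] have "key \<rho> < key (\<tau> - {v})" by simp
          moreover have "\<tau> - {v} \<in> \<Delta>" using \<tau>(1) down by blast
          ultimately show ?thesis using x \<tau>(1) by (simp add: E lead_def)
        qed (simp add: E \<tau>)
      qed
      with that(1) show False by (auto simp: S_def)
    qed
    have "finite (\<sigma> - \<tau>)" using that S finite_face by blast
    then have "\<tau> \<union> (\<sigma> - \<tau>) \<in> S \<longrightarrow> \<tau> \<in> S"
    proof (induction "\<sigma> - \<tau>" arbitrary: \<tau> rule: finite_induct)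
      case empty
      then show ?case by (metis Un_empty_right)
    next
      case (insert v F)
      have v: "v \<notin> \<tau>" "F = \<sigma> - insert v \<tau>" "insert v \<tau> \<union> F = \<tau> \<union> (\<sigma> - \<tau>)"
        using insert.hyps(2,4) by blast+
      from insert.hyps(3)[OF v(2)] v(2,3) step[of v \<tau>] v(1) show ?case by auto
    qed
    moreover have "\<tau> \<union> (\<sigma> - \<tau>) = \<sigma>" using that(2) by blast
    ultimately show ?thesis using that(1) by simp
  qed
  ultimately show ?thesis using S(1) by blast
qed

lemma wedge_face_vector:
  assumes "\<sigma> \<in> \<Delta>"
  shows "wedge q (face_vector \<sigma>) - (\<Sum>v \<in> {v. v \<notin> \<sigma> \<and> insert v \<sigma> \<in> \<Delta>}.
     scale_fun (q v * orientation_sign v (insert v \<sigma>)) (face_vector (insert v \<sigma>))) \<in> J"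
proof -
  define N where "N = {v. v \<notin> \<sigma> \<and> insert v \<sigma> \<in> \<Delta>}"
  have "N \<subseteq> \<Union>\<Delta>" by (auto simp: N_def)
  then have fN: "finite N" using finite_faces finite_face by (meson finite_Union finite_subset)
  let ?s = "\<Sum>v\<in>N. scale_fun (q v * orientation_sign v (insert v \<sigma>)) (face_vector (insert v \<sigma>))"
  have "wedge q (face_vector \<sigma>) \<tau> = ?s \<tau>" if \<tau>: "\<tau> \<in> \<Delta>" for \<tau>
  proof -
    have "?s \<tau> = (\<Sum>v\<in>N. if \<tau> = insert v \<sigma> then q v * orientation_sign v \<tau> else 0)"
      using fN
    proof (induction N rule: finite_induct)
      case (insert v N)
      then show ?case by (simp add: scale_fun_def face_vector_def)
    qed simp
    also have "\<dots> = (\<Sum>v\<in>\<tau> \<inter> N. if \<tau> = insert v \<sigma> then q v * orientation_sign v \<tau> else 0)"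
      by (rule sum.mono_neutral_right) (use fN in auto)
    also have "\<dots> = (\<Sum>v\<in>\<tau>. if \<tau> - {v} = \<sigma> then q v * orientation_sign v \<tau> else 0)"
      by (rule sum.mono_neutral_cong_left)
        (use finite_face[OF \<tau>] \<tau> in \<open>auto simp: N_def insert_absorb\<close>)
    also have "\<dots> = wedge q (face_vector \<sigma>) \<tau>"
      unfolding wedge_def face_vector_def by (rule sum.cong) auto
    finally show ?thesis by simp
  qed
  then have "wedge q (face_vector \<sigma>) - ?s \<in> vanishing \<Delta>" by (simp add: vanishing_def)
  with vanishing_sub show ?thesis unfolding N_def by blast
qed

text \<open>
  After \<open>basis_mod_double\<close>, the vectors \<open>wedge q (face_vector \<sigma>)\<close> are exchanged one at a time for single faces
  occurring in them; these cover \<open>\<sigma>\<close>. Independence of the resulting family makes all these faces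
  distinct and keeps them outside \<open>S\<close>.
\<close>

lemma basis_mod_double_faces:
  assumes ex: "cochain.exact_mod J (wedge q)" and S: "S \<subseteq> \<Delta>"
    and b: "cochain.basis_mod (cochain.add_image J (wedge q)) S face_vector"
  shows "\<exists>f. inj_on f S \<and> f ` S \<inter> S = {} \<and> (\<forall>\<sigma>\<in>S. \<exists>v. v \<notin> \<sigma> \<and> f \<sigma> = insert v \<sigma> \<and> f \<sigma> \<in> \<Delta>) \<and>
     cochain.basis_mod J (S \<union> f ` S) face_vector"
proof -
  have fS: "finite S" using S finite_faces finite_subset by blast
  define good where "good f \<sigma> \<longleftrightarrow> (\<exists>v. v \<notin> \<sigma> \<and> f \<sigma> = insert v \<sigma> \<and> f \<sigma> \<in> \<Delta>)" for f and \<sigma> :: "'a set"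
  define u :: "('a set \<Rightarrow> 'a set) \<Rightarrow> 'a set set \<Rightarrow> 'a set + 'a set \<Rightarrow> 'a set \<Rightarrow> 'k" where
    "u f R = case_sum face_vector (\<lambda>\<sigma>. if \<sigma> \<in> R then face_vector (f \<sigma>) else wedge q (face_vector \<sigma>))" for f R
  have "\<exists>f. (\<forall>\<sigma>\<in>R. good f \<sigma>) \<and> cochain.basis_mod J (S <+> S) (u f R)" if "R \<subseteq> S" for R
    using finite_subset[OF that fS] that
  proof (induction R rule: finite_induct)
    case empty
    have "cochain.basis_mod J (S <+> S) (case_sum face_vector (\<lambda>\<sigma>. wedge q (face_vector \<sigma>)))"
      by (rule cochain.basis_mod_double[OF subspace linear_wedge wedge_closed wedge_self ex b])
    then show ?case by (simp add: u_def)
  next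
    case (insert \<sigma> R)
    then obtain f where f: "\<forall>\<sigma>\<in>R. good f \<sigma>" "cochain.basis_mod J (S <+> S) (u f R)" by auto
    let ?N = "{v. v \<notin> \<sigma> \<and> insert v \<sigma> \<in> \<Delta>}"
    have \<sigma>: "\<sigma> \<in> \<Delta>" "Inr \<sigma> \<in> S <+> S" using insert.prems S by auto
    have "?N \<subseteq> \<Union>\<Delta>" by auto
    then have N: "finite ?N" using finite_faces finite_face by (meson finite_Union finite_subset)
    have "u f R (Inr \<sigma>) - (\<Sum>v\<in>?N. scale_fun (q v * orientation_sign v (insert v \<sigma>))
        (face_vector (insert v \<sigma>))) \<in> J"
      using wedge_face_vector[OF \<sigma>(1), of q] insert.hyps(2) by (simp add: u_def)
    from cochain.basis_mod_exchange[OF subspace f(2) \<sigma>(2) N this]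
    obtain v where v: "v \<in> ?N"
      and bm: "cochain.basis_mod J (S <+> S) ((u f R)(Inr \<sigma> := face_vector (insert v \<sigma>)))" by blast
    define g where "g = f(\<sigma> := insert v \<sigma>)"
    have "(u f R)(Inr \<sigma> := face_vector (insert v \<sigma>)) = u g (insert \<sigma> R)"
      by (rule ext) (auto simp: u_def g_def split: sum.split)
    with bm have "cochain.basis_mod J (S <+> S) (u g (insert \<sigma> R))" by simp
    moreover have "\<forall>\<tau>\<in>insert \<sigma> R. good g \<tau>" using f(1) v insert.hyps(2) by (auto simp: good_def g_def)
    ultimately show ?case by blast
  qed
  from this[of S] obtain f where f: "\<forall>\<sigma>\<in>S. good f \<sigma>" and bm: "cochain.basis_mod J (S <+> S) (u f S)" by auto
  define h where "h = case_sum (\<lambda>\<sigma>. \<sigma>) f"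
  have uh: "u f S i = face_vector (h i)" if "i \<in> S <+> S" for i
    using that by (auto simp: u_def h_def)
  have "inj_on (u f S) (S <+> S)" by (rule cochain.basis_mod_inj_on[OF subspace bm])
  then have h: "inj_on h (S <+> S)" using uh by (auto simp: inj_on_def)
  have bm': "cochain.basis_mod J (S <+> S) (\<lambda>i. face_vector (h i))"
  proof -
    have "(\<Sum>i\<in>S <+> S. scale_fun (a i) (face_vector (h i))) = (\<Sum>i\<in>S <+> S. scale_fun (a i) (u f S i))"
      for a by (intro sum.cong refl) (simp add: uh)
    with bm show ?thesis unfolding cochain.basis_mod_def by simp
  qed
  have "h ` (S <+> S) = S \<union> f ` S" by (force simp: h_def)
  with cochain.basis_mod_reindex[OF h bm'] have "cochain.basis_mod J (S \<union> f ` S) face_vector" by simp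
  moreover have "inj_on f S"
    by (rule inj_onI) (use inj_onD[OF h, of "Inr _" "Inr _"] in \<open>auto simp: h_def\<close>)
  moreover have "f ` S \<inter> S = {}"
    using inj_onD[OF h, of "Inl _" "Inr _"] by (fastforce simp: h_def)
  ultimately show ?thesis using f unfolding good_def by blast
qed

end

lemma face_ideal_vanishing:
  assumes "finite \<Delta>" "\<And>\<sigma>. \<sigma> \<in> \<Delta> \<Longrightarrow> finite \<sigma>" "\<And>\<sigma> \<tau>. \<sigma> \<in> \<Delta> \<Longrightarrow> \<tau> \<subseteq> \<sigma> \<Longrightarrow> \<tau> \<in> \<Delta>"
  shows "face_ideal \<Delta> (vanishing \<Delta>)"
proof
  fix q x assume x: "x \<in> vanishing \<Delta>"
  show "wedge q x \<in> vanishing \<Delta>"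
    unfolding vanishing_def mem_Collect_eq
  proof
    fix \<tau> assume "\<tau> \<in> \<Delta>"
    then have "\<tau> - {v} \<in> \<Delta>" for v using assms(3) by blast
    then show "wedge q x \<tau> = 0" using x by (auto simp: wedge_def vanishing_def)
  qed
qed (use assms subspace_vanishing in auto)

section \<open>Partition into boolean trees\<close>

theorem theorem4p5:
  fixes \<Delta> :: "'a set set" and k :: nat
  assumes "0 < k"
    and "simplicial_complex \<Delta>"
    and "k_fold_acyclic TYPE('f::field) k \<Delta>"
  shows "\<exists>\<T>. partition_on \<Delta> \<T> \<and> (\<forall>T\<in>\<T>. boolean_tree \<Delta> k T) \<and>
           subcomplex (\<Union>T\<in>\<T>. minimal_elements T) \<Delta>"
proof -
  have ne: "\<Delta> \<noteq> {}" and down: "\<And>\<sigma> \<tau>. \<sigma> \<in> \<Delta> \<Longrightarrow> \<tau> \<subseteq> \<sigma> \<Longrightarrow> \<tau> \<in> \<Delta>"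
    using assms(2) by (auto simp: simplicial_complex_def)
  obtain V where V: "finite V" "\<Delta> \<subseteq> Pow V" using assms(2) by (auto simp: simplicial_complex_def)
  have fin: "finite \<Delta>" "\<And>\<sigma>. \<sigma> \<in> \<Delta> \<Longrightarrow> finite \<sigma>"
    using V by (auto intro: finite_subset)
  have empty: "{} \<in> \<Delta>" using ne down by blast
  obtain c :: "'a \<Rightarrow> 'f alg_closure" where c: "inj_on c V"
  proof -
    obtain C :: "'f alg_closure set" where "finite C" "card C = card V"
      using infinite_arbitrarily_large[OF infinite_alg_closed] by blast
    then obtain g where "bij_betw g V C" using finite_same_card_bij[OF V(1)] by metis
    with that show ?thesis by (auto simp: bij_betw_def)
  qed
  define weight where "weight p = (\<lambda>v. poly p (c v))" for p
  have exact: "cochain.exact_mod (vanishing \<Delta>) (wedge (weight p))" if "p \<noteq> 0" "degree p < k" for p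
    unfolding wedge_exact_iff[symmetric]
  proof (rule k_fold_wedge_exact)
    show "finite {v \<in> V. weight p v = 0}" using V by simp
    have "c ` {v \<in> V. weight p v = 0} \<subseteq> {x. poly p x = 0}" by (auto simp: weight_def)
    then have "card (c ` {v \<in> V. weight p v = 0}) \<le> card {x. poly p x = 0}"
      by (rule card_mono[OF poly_roots_finite[OF that(1)]])
    also have "\<dots> \<le> degree p" by (rule card_poly_roots_bound[OF that(1)])
    also have "card (c ` {v \<in> V. weight p v = 0}) = card {v \<in> V. weight p v = 0}"
      by (rule card_image[OF inj_on_subset[OF c]]) auto
    finally show "card {v \<in> V. weight p v = 0} < k" using that(2) by simp
    show "v \<in> {v \<in> V. weight p v = 0}" if "v \<in> \<Union>\<Delta>" "weight p v = 0" for v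
      using that V by blast
    fix \<sigma> and q :: "'a \<Rightarrow> 'f alg_closure"
    assume \<sigma>: "\<sigma> \<in> \<Delta>" "card \<sigma> < k" and q: "\<And>v. v \<in> \<Union>(link \<Delta> \<sigma>) \<Longrightarrow> q v \<noteq> 0"
    show "wedge_exact (link \<Delta> \<sigma>) q"
    proof (rule acyclic_imp_wedge_exact)
      show "acyclic_over TYPE('f) (link \<Delta> \<sigma>)"
        using assms(3) \<sigma> by (simp add: k_fold_acyclic_def)
      show "\<tau> \<in> link \<Delta> \<sigma>" if "\<rho> \<in> link \<Delta> \<sigma>" "\<tau> \<subseteq> \<rho>" for \<rho> \<tau>
        using that down[of \<rho> \<tau>] down[of "\<rho> \<union> \<sigma>" "\<tau> \<union> \<sigma>"] by (auto simp: link_def)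
    qed (use fin q in \<open>auto simp: link_def\<close>)
  qed (use down fin empty in auto)
  define J where "J = rec_nat (vanishing \<Delta>) (\<lambda>i J. cochain.add_image J (wedge (weight (monom 1 i))))"
  have J0: "J 0 = vanishing \<Delta>" and JS: "J (Suc i) = cochain.add_image (J i) (wedge (weight (monom 1 i)))" for i
    by (simp_all add: J_def)
  have ideal: "face_ideal \<Delta> (J i)" for i
    by (induction i) (use face_ideal_vanishing[OF fin down] face_ideal.face_ideal_add_image in \<open>auto simp: J0 JS\<close>)
  \<comment> \<open>The multiples of \<open>monom 1 i\<close> of degree below \<open>k\<close> are the combinations of \<open>\<theta>\<^sub>i, \<dots>, \<theta>\<^sub>k\<^sub>-\<^sub>1\<close>. The induction carries
    exactness of all of them, since each step needs the whole pencil spanned by \<open>\<theta>\<^sub>i\<close> and a combination of later forms.\<close>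
  have exactJ: "cochain.exact_mod (J i) (wedge (weight (monom 1 i * p)))"
    if "p \<noteq> 0" "i + degree p < k" for i p
    using that
  proof (induction i arbitrary: p)
    case 0
    then show ?case using exact[of p] by (simp add: J0 flip: one_pCons)
  next
    case (Suc i)
    let ?f = "wedge (weight (monom 1 i))" and ?g = "wedge (weight (monom 1 (Suc i) * p))"
    interpret face_ideal \<Delta> "J i" by (rule ideal)
    have B: "cochain.span (face_vector ` \<Delta> \<union> J i) = UNIV"
      using cochain.span_mono[of "face_vector ` \<Delta> \<union> vanishing \<Delta>" "face_vector ` \<Delta> \<union> J i"]
        vanishing_sub span_face_vectors[OF fin(1)] by blast
    show ?case
      unfolding JS
    proof (rule cochain.exact_mod_add_image[OF _ subspace finite_imageI[OF fin(1)] B linear_wedge linear_wedge])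
      show "\<exists>l. poly r l = 0" if "degree r > 0" for r :: "'f alg_closure poly"
        using alg_closed_imp_poly_has_root[OF that] .
      show "cochain.exact_mod (J i) ?f" using Suc.IH[of 1] Suc.prems by simp
      fix l
      have eq: "?g x - scale_fun l (?f x) = wedge (weight (monom 1 i * (monom 1 1 * p - [:l:]))) x" for x
      proof -
        have "?g x = wedge (\<lambda>v. weight (monom 1 i * (monom 1 1 * p - [:l:])) v + l * weight (monom 1 i) v) x"
          by (rule arg_cong[of _ _ "\<lambda>w. wedge w x"])
            (auto simp: weight_def poly_monom algebra_simps)
        moreover have "wedge (\<lambda>v. l * weight (monom 1 i) v) x = scale_fun l (?f x)"
          by (rule ext) (simp add: wedge_def scale_fun_def sum_distrib_left algebra_simps)
        ultimately show ?thesis by (simp add: wedge_add_weights)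
      qed
      have d: "degree (monom 1 1 * p) = Suc (degree p)"
        using Suc.prems by (simp add: degree_mult_eq degree_monom_eq monom_eq_0_iff)
      have "monom 1 1 * p - [:l:] \<noteq> 0" using d by (metis degree_pCons_0 eq_iff_diff_eq_0 nat.distinct(1))
      moreover have "degree (monom 1 1 * p - [:l:]) \<le> Suc (degree p)"
        by (rule degree_diff_le) (simp_all only: d degree_pCons_0 order_refl le0)
      ultimately show "cochain.exact_mod (J i) (\<lambda>x. ?g x - scale_fun l (?f x))"
        unfolding eq using Suc.IH[of "monom 1 1 * p - [:l:]"] Suc.prems by simp
    qed (erule wedge_closed | rule wedge_self wedge_anticommute)+
  qed
  interpret Jk: face_ideal \<Delta> "J k" by (rule ideal)
  obtain S where S: "S \<subseteq> \<Delta>" "\<forall>\<sigma>\<in>S. \<forall>\<tau>. \<tau> \<subseteq> \<sigma> \<longrightarrow> \<tau> \<in> S" "cochain.basis_mod (J k) S face_vector"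
    using Jk.standard_faces by blast
  have "\<exists>A \<T>. A \<subseteq> \<Delta> \<and> cochain.basis_mod (J (k - i)) A face_vector \<and> partition_on A \<T> \<and>
      (\<forall>T\<in>\<T>. boolean_tree \<Delta> i T) \<and> (\<Union>T\<in>\<T>. minimal_elements T) = S" if "i \<le> k" for i
    using that
  proof (induction i)
    case 0
    have "partition_on S ((\<lambda>\<sigma>. {\<sigma>}) ` S)" by (auto simp: partition_on_def disjoint_def)
    moreover have "minimal_elements {\<sigma>} = {\<sigma>}" for \<sigma> :: "'a set" by (rule minimal_elements_eqI) auto
    ultimately show ?case using S by (intro exI[of _ S] exI[of _ "(\<lambda>\<sigma>. {\<sigma>}) ` S"]) (auto intro: boolean_tree.single)
  next
    case (Suc i)
    then obtain A \<T> where A: "A \<subseteq> \<Delta>" "cochain.basis_mod (J (k - i)) A face_vector" "partition_on A \<T>"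
      "\<And>T. T \<in> \<T> \<Longrightarrow> boolean_tree \<Delta> i T" "(\<Union>T\<in>\<T>. minimal_elements T) = S" by auto
    define j where "j = k - Suc i"
    have j: "k - i = Suc j" "j < k" using Suc.prems by (auto simp: j_def)
    interpret face_ideal \<Delta> "J j" by (rule ideal)
    have "cochain.exact_mod (J j) (wedge (weight (monom 1 j)))" using exactJ[of 1 j] j by simp
    from basis_mod_double_faces[OF this A(1)] A(2) obtain f where
      f: "inj_on f A" "f ` A \<inter> A = {}" "\<forall>\<sigma>\<in>A. \<exists>v. v \<notin> \<sigma> \<and> f \<sigma> = insert v \<sigma> \<and> f \<sigma> \<in> \<Delta>"
        "cochain.basis_mod (J j) (A \<union> f ` A) face_vector"
      unfolding j JS by blast
    have "covers \<Delta> (f \<sigma>) \<sigma>" if "\<sigma> \<in> A" for \<sigma>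
    proof -
      from f(3) that obtain v where "v \<notin> \<sigma>" "f \<sigma> = insert v \<sigma>" "f \<sigma> \<in> \<Delta>" by blast
      with A(1) that show ?thesis by (auto simp: covers_def)
    qed
    from boolean_tree_partition_grow[OF A(3,4) f(1,2) this] obtain \<U> where
      "partition_on (A \<union> f ` A) \<U>" "\<forall>T\<in>\<U>. boolean_tree \<Delta> (Suc i) T" "(\<Union>T\<in>\<U>. minimal_elements T) = S"
      using A(5) by auto
    with f(3,4) A(1) show ?case unfolding j_def by (intro exI[of _ "A \<union> f ` A"] exI[of _ \<U>]) auto
  qed
  from this[of k] obtain A \<T> where A: "A \<subseteq> \<Delta>" "cochain.basis_mod (J 0) A face_vector"
    "partition_on A \<T>" "\<forall>T\<in>\<T>. boolean_tree \<Delta> k T" "(\<Union>T\<in>\<T>. minimal_elements T) = S"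
    by auto
  have "\<Delta> \<subseteq> A"
  proof
    fix \<sigma> assume \<sigma>: "\<sigma> \<in> \<Delta>"
    from A(2) obtain a where "face_vector \<sigma> - (\<Sum>i\<in>A. scale_fun (a i) (face_vector i)) \<in> J 0"
      unfolding cochain.basis_mod_def by blast
    then have "(face_vector \<sigma> \<sigma> :: 'f alg_closure) = (\<Sum>i\<in>A. scale_fun (a i) (face_vector i)) \<sigma>"
      using \<sigma> by (simp add: J0 vanishing_def)
    then show "\<sigma> \<in> A"
      unfolding sum_face_vector[OF finite_subset[OF A(1) fin(1)]]
      by (simp add: face_vector_def split: if_splits)
  qed
  with A(1) have "A = \<Delta>" by blast
  have "S \<noteq> {}"
  proof -
    have "\<T> \<noteq> {}" using A(3) ne \<open>A = \<Delta>\<close> by (auto simp: partition_on_def)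
    then obtain T where "T \<in> \<T>" by blast
    with A(4) boolean_tree_unique_minimal[of \<Delta> k T] have "minimal_elements T \<noteq> {}" by blast
    with A(5) \<open>T \<in> \<T>\<close> show ?thesis by blast
  qed
  then have "subcomplex S \<Delta>"
    using S(1,2) V by (auto simp: subcomplex_def simplicial_complex_def intro!: exI[of _ V])
  with A \<open>A = \<Delta>\<close> show ?thesis by blast
qed

end
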